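(* Work in two space dimensions, with $M\ge 0$, a kernel $\mathsf J=\mathsf J_c-\mathsf J_e$ and constants $\gamma_c,\gamma_e\ge 0$ satisfying the assumptions (A1)–(A3) and $\gamma_0>0$ stated in the context. Let smooth, $\Omega$-periodic initial data $\Phi(\cdot,\cdot,0)$ be given, and suppose that $\Phi(x_1,x_2,t)$ is the unique, smooth, $\Omega$-periodic solution on $\Omega$ for $0\le t\le T$, for some $T<\infty$, of the nonlocal Allen–Cahn equation $$\partial_t\Phi=-M\big(\Phi^3+\gamma_c\Phi-\gamma_e\Phi+(\mathsf J*1)\Phi-\mathsf J*\Phi\big).$$ Set $\Phi^k_{i,j}:=\Phi(p_i,p_j,ks)$. Let $\phi^k\in\mathcal C_{m\times n}$ be the $k$-th periodic solution of the fully discrete nAC scheme defined in the context with time step $s$, grid size $h$ and starting value $\phi^0_{i,j}:=\Phi^0_{i,j}$. Put $e^k_{i,j}:=\Phi^k_{i,j}-\phi^k_{i,j}$. Then there exist $s_0,h_0>0$ and a constant $C>0$, with $C$ independent of $h$ and $s$, such that whenever $0<s\le s_0$ and $0<h\le h_0$, $$\|e^l\|_2\le C\,(h^2+s^2)$$ for all positive integers $l$ such that $l\,s\le T$.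
   Context: Continuous setting: $\Omega=(0,L_1)\times(0,L_2)$; $C^\infty_{\rm per}(\Omega)$ is the set of smooth $\Omega$-periodic functions on $\mathbb R^2$. The kernel is $\mathsf J=\mathsf J_c-\mathsf J_e$ where: (A1) $\mathsf J_c,\mathsf J_e\in C^\infty_{\rm per}(\Omega)$ are non-negative; (A2) $\mathsf J_c,\mathsf J_e$ are even, $\mathsf J_\alpha(-x_1,-x_2)=\mathsf J_\alpha(x_1,x_2)$; (A3) $\int_\Omega\mathsf J\,d\mathbf x>0$. Periodic convolution: $(\mathsf J*\phi)(\mathbf x)=\int_\Omega\mathsf J(\mathbf y)\phi(\mathbf x-\mathbf y)\,d\mathbf y$; in particular $\mathsf J*1=\int_\Omega \mathsf J\,d\mathbf x$. Constants $\gamma_c,\gamma_e\ge0$ satisfy $\gamma_0:=\gamma_c-\gamma_e+\mathsf J*1>0$. Grid: $h>0$ with $L_1=m h$, $L_2=n h$, $m,n$ positive integers; $p_r:=(r-\tfrac12)h$ for integer or half-integer $r$. $\mathcal C_{m\times n}$ is the space of cell-centered grid functions $\phi_{i,j}=\phi(p_i,p_j)$, $1\le i\le m$, $1\le j\le n$; periodic ones are extended by $\phi_{i+am,j+bn}=\phi_{i,j}$, $a,b\in\mathbb Z$. $\|\phi\|_2=\big(h^2\sum_{i=1}^m\sum_{j=1}^n\phi_{i,j}^2\big)^{1/2}$. For a vertex-centered periodic grid function $f_{k+\frac12,l+\frac12}=f(p_{k+\frac12},p_{l+\frac12})$ and periodic $\phi\in\mathcal C_{m\times n}$, the discrete convolution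 is $[f\star\phi]_{i,j}=h^2\sum_{k=1}^m\sum_{l=1}^n f_{k+\frac12,l+\frac12}\,\phi_{i-k,j-l}$. $J_c,J_e$ denote the vertex-centered grid restrictions $(J_\alpha)_{i+\frac12,j+\frac12}=\mathsf J_\alpha(p_{i+\frac12},p_{j+\frac12})$, $J=J_c-J_e$, and $\mathbf 1$ is the constant grid function 1 (so $[J_\alpha\star\mathbf 1]$ is a constant). Fully discrete nAC scheme with time step $s>0$: given periodic $\phi^{k-1},\phi^k\in\mathcal C_{m\times n}$, $k\ge0$, with the convention $\phi^{-1}:=\phi^0$, find periodic $\phi^{k+1}\in\mathcal C_{m\times n}$ (it exists and is unique) such that $$\phi^{k+1}-\phi^k=-M s\,w^{k+1/2},$$ $$w^{k+1/2}=\eta(\phi^k,\phi^{k+1})+([J_c\star\mathbf 1]+\gamma_c)\phi^{k+1/2}-([J_e\star\mathbf 1]+\gamma_e)\hat\phi^{k+1/2}-[J\star\hat\phi^{k+1/2}],$$ where $\eta(\phi^k,\phi^{k+1})=\tfrac14\big((\phi^k)^2+(\phi^{k+1})^2\big)(\phi^k+\phi^{k+1})$, $\phi^{k+1/2}=\tfrac12(\phi^k+\phi^{k+1})$, $\hat\phi^{k+1/2}=\tfrac32\phi^k-\tfrac12\phi^{k-1}$. *)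

theory Defs
  imports "HOL-Analysis.Analysis"
begin

text \<open>
  Derivatives are taken within \<open>S\<close>, so on \<open>\<real>\<^sup>2 \<times> [0,T]\<close> with \<open>T > 0\<close> they are one-sided in time
  at the two end points; such \<open>S\<close> is the closure of its interior, hence the derivative is unique.
\<close>

primrec Ck_on :: "nat \<Rightarrow> ('a::real_normed_vector \<Rightarrow> 'b::real_normed_vector) \<Rightarrow> 'a set \<Rightarrow> bool" where
  "Ck_on 0 f S \<longleftrightarrow> continuous_on S f"
| "Ck_on (Suc k) f S \<longleftrightarrow>
     (\<exists>D. (\<forall>x\<in>S. (f has_derivative D x) (at x within S)) \<and> (\<forall>v. Ck_on k (\<lambda>x. D x v) S))"

definition smooth_on :: "('a::real_normed_vector \<Rightarrow> 'b::real_normed_vector) \<Rightarrow> 'a set \<Rightarrow> bool" where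
  "smooth_on f S \<longleftrightarrow> (\<forall>k. Ck_on k f S)"

definition Omega :: "real \<Rightarrow> real \<Rightarrow> (real \<times> real) set" where
  "Omega L1 L2 = {0<..<L1} \<times> {0<..<L2}"

definition periodic :: "real \<Rightarrow> real \<Rightarrow> (real \<times> real \<Rightarrow> real) \<Rightarrow> bool" where
  "periodic L1 L2 f \<longleftrightarrow>
     (\<forall>x1 x2. f (x1 + L1, x2) = f (x1, x2) \<and> f (x1, x2 + L2) = f (x1, x2))"

definition Cinf_per :: "real \<Rightarrow> real \<Rightarrow> (real \<times> real \<Rightarrow> real) \<Rightarrow> bool" where
  "Cinf_per L1 L2 f \<longleftrightarrow> smooth_on f UNIV \<and> periodic L1 L2 f"

definition pconv ::
    "real \<Rightarrow> real \<Rightarrow> (real \<times> real \<Rightarrow> real) \<Rightarrow> (real \<times> real \<Rightarrow> real) \<Rightarrow> real \<times> real \<Rightarrow> real" where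
  "pconv L1 L2 J f x = integral (Omega L1 L2) (\<lambda>y. J y * f (x - y))"

lemma pconv_one: "pconv L1 L2 J (\<lambda>_. 1) x = integral (Omega L1 L2) J"
  by (simp add: pconv_def)

text \<open>
  Smooth periodic solution of the nonlocal Allen--Cahn equation on \<open>[0,T]\<close> with initial value \<open>\<Phi>0\<close>.
  The values \<open>\<Phi> x t\<close> for \<open>t\<close> outside \<open>[0,T]\<close> are irrelevant.
\<close>

definition nAC_solution ::
    "real \<Rightarrow> real \<Rightarrow> real \<Rightarrow> real \<Rightarrow> real \<Rightarrow> (real \<times> real \<Rightarrow> real) \<Rightarrow> real \<Rightarrow>
     (real \<times> real \<Rightarrow> real) \<Rightarrow> (real \<times> real \<Rightarrow> real \<Rightarrow> real) \<Rightarrow> bool" where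
  "nAC_solution L1 L2 M \<gamma>c \<gamma>e J T \<Phi>0 \<Phi> \<longleftrightarrow>
     smooth_on (\<lambda>(x, t). \<Phi> x t) (UNIV \<times> {0..T}) \<and>
     (\<forall>t\<in>{0..T}. periodic L1 L2 (\<lambda>x. \<Phi> x t)) \<and>
     (\<forall>x. \<Phi> x 0 = \<Phi>0 x) \<and>
     (\<forall>x\<in>Omega L1 L2. \<forall>t\<in>{0..T}.
        ((\<lambda>\<tau>. \<Phi> x \<tau>) has_real_derivative
           - M * ((\<Phi> x t)^3 + \<gamma>c * \<Phi> x t - \<gamma>e * \<Phi> x t
                  + pconv L1 L2 J (\<lambda>_. 1) x * \<Phi> x t
                  - pconv L1 L2 J (\<lambda>y. \<Phi> y t) x)) (at t within {0..T}))"

text \<open>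
  Grid functions are indexed by all of \<open>\<int> \<times> \<int>\<close>.  For a vertex-centered grid function the index
  \<open>(k, l)\<close> stands for the half-integer index \<open>(k + 1/2, l + 1/2)\<close>.
\<close>

type_synonym grid = "int \<Rightarrow> int \<Rightarrow> real"

definition gp :: "real \<Rightarrow> real \<Rightarrow> real" where
  "gp h r = (r - 1/2) * h"

definition cell_restrict :: "real \<Rightarrow> (real \<times> real \<Rightarrow> real) \<Rightarrow> grid" where
  "cell_restrict h f = (\<lambda>i j. f (gp h (of_int i), gp h (of_int j)))"

definition vert_restrict :: "real \<Rightarrow> (real \<times> real \<Rightarrow> real) \<Rightarrow> grid" where
  "vert_restrict h f = (\<lambda>k l. f (gp h (of_int k + 1/2), gp h (of_int l + 1/2)))"

definition grid_periodic :: "nat \<Rightarrow> nat \<Rightarrow> grid \<Rightarrow> bool" where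
  "grid_periodic m n \<phi> \<longleftrightarrow> (\<forall>i j a b. \<phi> (i + a * int m) (j + b * int n) = \<phi> i j)"

definition grid_norm2 :: "real \<Rightarrow> nat \<Rightarrow> nat \<Rightarrow> grid \<Rightarrow> real" where
  "grid_norm2 h m n \<phi> = sqrt (h^2 * (\<Sum>i=1..int m. \<Sum>j=1..int n. (\<phi> i j)^2))"

definition dconv :: "real \<Rightarrow> nat \<Rightarrow> nat \<Rightarrow> grid \<Rightarrow> grid \<Rightarrow> grid" where
  "dconv h m n f \<phi> = (\<lambda>i j. h^2 * (\<Sum>k=1..int m. \<Sum>l=1..int n. f k l * \<phi> (i - k) (j - l)))"

definition eta :: "real \<Rightarrow> real \<Rightarrow> real" where
  "eta a b = 1/4 * (a^2 + b^2) * (a + b)"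

text \<open>
  The potential \<open>w\<^sup>k\<^sup>+\<^sup>1\<^sup>/\<^sup>2\<close> as a function of \<open>\<phi>\<^sup>k\<^sup>-\<^sup>1\<close>, \<open>\<phi>\<^sup>k\<close>, \<open>\<phi>\<^sup>k\<^sup>+\<^sup>1\<close> (called \<open>\<phi>m\<close>, \<open>\<phi>\<close>, \<open>\<phi>p\<close>);
  \<open>Jc\<close> and \<open>Je\<close> are the vertex-centered grid kernels.
\<close>

definition nAC_potential ::
    "real \<Rightarrow> nat \<Rightarrow> nat \<Rightarrow> real \<Rightarrow> real \<Rightarrow> grid \<Rightarrow> grid \<Rightarrow> grid \<Rightarrow> grid \<Rightarrow> grid \<Rightarrow> grid" where
  "nAC_potential h m n \<gamma>c \<gamma>e Jc Je \<phi>m \<phi> \<phi>p =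
     (let one = (\<lambda>_ _. 1);
          J = (\<lambda>k l. Jc k l - Je k l);
          half = (\<lambda>i j. 1/2 * (\<phi> i j + \<phi>p i j));
          hat = (\<lambda>i j. 3/2 * \<phi> i j - 1/2 * \<phi>m i j)
      in (\<lambda>i j. eta (\<phi> i j) (\<phi>p i j)
            + (dconv h m n Jc one i j + \<gamma>c) * half i j
            - (dconv h m n Je one i j + \<gamma>e) * hat i j
            - dconv h m n J hat i j))"

text \<open>For \<open>k = 0\<close> the truncated \<open>k - 1 = 0\<close> on \<^typ>\<open>nat\<close> is exactly the convention \<open>\<phi>\<^sup>-\<^sup>1 := \<phi>\<^sup>0\<close>.\<close>

definition nAC_scheme ::
    "real \<Rightarrow> nat \<Rightarrow> nat \<Rightarrow> real \<Rightarrow> real \<Rightarrow> real \<Rightarrow> real \<Rightarrow> grid \<Rightarrow> grid \<Rightarrow> (nat \<Rightarrow> grid) \<Rightarrow> bool" where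
  "nAC_scheme h m n s M \<gamma>c \<gamma>e Jc Je \<phi> \<longleftrightarrow>
     (\<forall>k. grid_periodic m n (\<phi> k)) \<and>
     (\<forall>k i j. \<phi> (Suc k) i j - \<phi> k i j =
        - M * s * nAC_potential h m n \<gamma>c \<gamma>e Jc Je (\<phi> (k - 1)) (\<phi> k) (\<phi> (Suc k)) i j)"

end

theory Submission
  imports Defs
begin

text \<open>
  The scheme is analysed pointwise, in the maximum norm, which dominates \<open>\<parallel>\<cdot>\<parallel>\<^sub>2\<close> on the bounded domain.
  The term \<open>\<eta>(\<phi>\<^sup>k, \<phi>\<^sup>k\<^sup>+\<^sup>1)\<close> is nondecreasing in \<open>\<phi>\<^sup>k\<^sup>+\<^sup>1\<close> and the coefficient of \<open>\<phi>\<^sup>k\<^sup>+\<^sup>1\<^sup>/\<^sup>2\<close> is nonnegative,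
  so the new error enters with a favourable sign; with the convolution bounded on the maximum norm
  this gives \<open>|e\<^sup>k\<^sup>+\<^sup>1| \<le> (1 + c s) max |e\<^sup>k| |e\<^sup>k\<^sup>-\<^sup>1| + s \<tau>\<^sub>k\<close> as long as the errors stay below 1, which a discrete
  Gronwall argument then perpetuates.  The truncation error \<open>\<tau>\<^sub>k\<close> is \<open>O(s\<^sup>2 + h\<^sup>2)\<close>, except that \<open>\<phi>\<^sup>-\<^sup>1 = \<phi>\<^sup>0\<close>
  makes \<open>\<tau>\<^sub>0 = O(s + h\<^sup>2)\<close>; being weighted with \<open>s\<close> only once, this is harmless.  Every consistency
  estimate is a bound on a symmetric second difference of a smooth function.
\<close>

subsection \<open>Difference bounds for smooth functions\<close>

text \<open>\<open>Ck_on\<close> gives regularity of \<open>D x v\<close> in \<open>x\<close> only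
  for each fixed direction \<open>v\<close>. Expanding \<open>v\<close> in the basis turns such
  directional bounds into a bound on the operator norm.\<close>

lemma linear_bound_by_basis:
  fixes L :: "'a::euclidean_space \<Rightarrow> real"
  assumes "linear L" "\<And>b. b \<in> Basis \<Longrightarrow> \<bar>L b\<bar> \<le> C b"
  shows "\<bar>L v\<bar> \<le> (\<Sum>b\<in>Basis. C b) * norm v"
proof -
  have "L v = L (\<Sum>b\<in>Basis. (v \<bullet> b) *\<^sub>R b)"
    by (simp add: euclidean_representation)
  also have "\<dots> = (\<Sum>b\<in>Basis. (v \<bullet> b) * L b)"
    using assms(1) by (simp add: linear_sum linear_cmul)
  finally have "\<bar>L v\<bar> = \<bar>\<Sum>b\<in>Basis. (v \<bullet> b) * L b\<bar>" by simp
  also have "\<dots> \<le> (\<Sum>b\<in>Basis. norm v * C b)"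
  proof (rule order_trans[OF sum_abs], rule sum_mono)
    fix b :: 'a assume b: "b \<in> Basis"
    show "\<bar>(v \<bullet> b) * L b\<bar> \<le> norm v * C b"
      using mult_mono[OF Basis_le_norm[OF b] assms(2)[OF b]] by (simp add: abs_mult)
  qed
  finally show ?thesis by (simp add: sum_distrib_left mult.commute)
qed

lemma Ck_on_imp_continuous_on: "Ck_on k f S \<Longrightarrow> continuous_on S f"
  by (cases k) (auto, meson continuous_on_eq_continuous_within has_derivative_continuous)

text \<open>Mean value inequality on the convex set \<open>K\<close>: the directional derivatives
  are continuous, hence bounded on the compact \<open>K\<close>.\<close>

lemma Ck_on_lipschitz:
  fixes f :: "'a::euclidean_space \<Rightarrow> real"
  assumes f: "Ck_on 1 f S" and K: "K \<subseteq> S" "compact K" "convex K"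
  obtains B where "0 \<le> B" "\<And>x y. x \<in> K \<Longrightarrow> y \<in> K \<Longrightarrow> \<bar>f x - f y\<bar> \<le> B * norm (x - y)"
proof -
  obtain D where D: "\<And>x. x \<in> S \<Longrightarrow> (f has_derivative D x) (at x within S)"
    and cont: "\<And>v. continuous_on S (\<lambda>x. D x v)"
    using f by auto
  have "\<exists>c. \<forall>x\<in>K. \<bar>D x b\<bar> \<le> c" for b
  proof -
    have "compact ((\<lambda>x. D x b) ` K)"
      by (intro compact_continuous_image continuous_on_subset[OF cont] K)
    then show ?thesis
      by (auto dest!: compact_imp_bounded simp: bounded_iff)
  qed
  then obtain C where C: "\<And>b x. x \<in> K \<Longrightarrow> \<bar>D x b\<bar> \<le> C b" by metis
  \<comment> \<open>The absolute value keeps \<open>B\<close> nonnegative also for empty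
    \<open>K\<close>, where \<open>C\<close> is arbitrary.\<close>
  define B where "B = \<bar>\<Sum>b\<in>Basis. C b\<bar>"
  have on: "onorm (D x) \<le> B" if x: "x \<in> K" for x
  proof (rule onorm_le)
    fix v
    have "linear (D x)" using D[of x] x K(1) has_derivative_linear by blast
    from linear_bound_by_basis[OF this C[OF x], of v]
    show "norm (D x v) \<le> B * norm v"
      unfolding B_def
      by (metis abs_ge_self mult_right_mono norm_ge_zero order_trans real_norm_def)
  qed
  show thesis
  proof
    show "0 \<le> B" by (simp add: B_def)
    show "\<bar>f x - f y\<bar> \<le> B * norm (x - y)" if "x \<in> K" "y \<in> K" for x y
      using differentiable_bound[of K f D B x y] K on that
      by (auto intro: has_derivative_subset[OF D])
  qed
qed

text \<open>Along the segment through \<open>p\<close>, the even combination \<open>g\<close> of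
  values of \<open>f\<close> has a derivative that is a difference of \<open>D\<close> at two points
  at distance at most twice the norm of \<open>v\<close>. The Lipschitz bound on \<open>D\<close>
  makes it quadratic in \<open>v\<close>, so a mean value inequality replaces a second-order Taylor
  expansion. One constant serves values, first differences and second differences.\<close>

lemma second_difference_bound:
  fixes f :: "'a::euclidean_space \<Rightarrow> real"
  assumes f: "Ck_on 2 f S" and K: "K \<subseteq> S" "compact K" "convex K"
  obtains B where "0 \<le> B" "\<And>p. p \<in> K \<Longrightarrow> \<bar>f p\<bar> \<le> B"
    "\<And>p q. p \<in> K \<Longrightarrow> q \<in> K \<Longrightarrow> \<bar>f p - f q\<bar> \<le> B * norm (p - q)"
    "\<And>p v. p + v \<in> K \<Longrightarrow> p - v \<in> K \<Longrightarrow> \<bar>f (p + v) + f (p - v) - 2 * f p\<bar> \<le> B * (norm v)\<^sup>2"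
proof -
  obtain D where D: "\<And>x. x \<in> S \<Longrightarrow> (f has_derivative D x) (at x within S)"
    and D1: "\<And>v. Ck_on 1 (\<lambda>x. D x v) S"
    using f by (auto simp: numeral_2_eq_2)
  have "continuous_on S f" by (rule Ck_on_imp_continuous_on[OF f])
  then have "compact (f ` K)"
    by (intro compact_continuous_image K) (rule continuous_on_subset[OF _ K(1)])
  then have "\<exists>c. \<forall>p\<in>K. \<bar>f p\<bar> \<le> c"
    by (auto dest!: compact_imp_bounded simp: bounded_iff)
  then obtain B0 where B0: "\<And>p. p \<in> K \<Longrightarrow> \<bar>f p\<bar> \<le> B0" by blast
  have "Ck_on 1 f S" using D Ck_on_imp_continuous_on[OF D1] by auto
  then obtain B1 where B1: "0 \<le> B1"
      "\<And>x y. x \<in> K \<Longrightarrow> y \<in> K \<Longrightarrow> \<bar>f x - f y\<bar> \<le> B1 * norm (x - y)"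
    using Ck_on_lipschitz[OF _ K] by metis
  have "\<exists>c. \<forall>x\<in>K. \<forall>y\<in>K. \<bar>D x b - D y b\<bar> \<le> c * norm (x - y)" for b
    using Ck_on_lipschitz[OF D1 K, of b] by metis
  then obtain C where C: "\<And>b x y. x \<in> K \<Longrightarrow> y \<in> K \<Longrightarrow> \<bar>D x b - D y b\<bar> \<le> C b * norm (x - y)"
    by metis
  define B2 where "B2 = \<bar>\<Sum>b\<in>Basis. C b\<bar>"
  have Dlip: "\<bar>D x v - D y v\<bar> \<le> B2 * norm (x - y) * norm v" if "x \<in> K" "y \<in> K" for x y v
  proof -
    have "linear (D x)" "linear (D y)"
      using D that K(1) has_derivative_linear by blast+
    then have "linear (\<lambda>v. D x v - D y v)" by (rule linear_compose_sub)
    from linear_bound_by_basis[OF this C[OF that], of v]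
    have "\<bar>D x v - D y v\<bar> \<le> (\<Sum>b\<in>Basis. C b) * norm (x - y) * norm v"
      by (simp add: sum_distrib_right)
    also have "\<dots> \<le> B2 * norm (x - y) * norm v"
      unfolding B2_def by (intro mult_right_mono) auto
    finally show ?thesis .
  qed
  have B2: "\<bar>f (p + v) + f (p - v) - 2 * f p\<bar> \<le> 2 * B2 * (norm v)\<^sup>2"
    if pv: "p + v \<in> K" "p - v \<in> K" for p v
  proof -
    \<comment> \<open>Only the two end points are given in \<open>K\<close>; convexity supplies the
      segment between them.\<close>
    have seg: "p + \<tau> *\<^sub>R v \<in> K" if "\<bar>\<tau>\<bar> \<le> 1" for \<tau>
    proof -
      have "((1 + \<tau>) / 2) *\<^sub>R (p + v) + ((1 - \<tau>) / 2) *\<^sub>R (p - v) \<in> K"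
        using that by (intro convexD[OF K(3)] pv) (auto simp: field_simps abs_le_iff)
      also have "((1 + \<tau>) / 2) *\<^sub>R (p + v) + ((1 - \<tau>) / 2) *\<^sub>R (p - v) =
          ((1 + \<tau>) / 2 + (1 - \<tau>) / 2) *\<^sub>R p + ((1 + \<tau>) / 2 - (1 - \<tau>) / 2) *\<^sub>R v"
        unfolding scaleR_add_left scaleR_left_diff_distrib scaleR_add_right scaleR_diff_right by simp
      also have "\<dots> = p + \<tau> *\<^sub>R v"
        by (simp flip: add_divide_distrib diff_divide_distrib)
      finally show ?thesis .
    qed
    define g where "g = (\<lambda>\<tau>::real. f (p + \<tau> *\<^sub>R v) + f (p + (- \<tau>) *\<^sub>R v))"
    have line: "((\<lambda>\<tau>. f (p + (c * \<tau>) *\<^sub>R v)) has_derivative (\<lambda>\<sigma>. D (p + (c * \<tau>) *\<^sub>R v) ((c * \<sigma>) *\<^sub>R v)))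
        (at \<tau> within {0..1})" if "\<tau> \<in> {0..1}" "\<bar>c\<bar> = 1" for c \<tau> :: real
    proof (rule has_derivative_in_compose2[where t = K])
      show "(f has_derivative D x) (at x within K)" if "x \<in> K" for x
        using has_derivative_subset[OF D] that K(1) by blast
      show "(\<lambda>\<tau>. p + (c * \<tau>) *\<^sub>R v) ` {0..1} \<subseteq> K"
        using that by (auto intro!: seg simp: abs_mult)
    qed (use that in \<open>auto intro!: derivative_eq_intros\<close>)
    have "norm (g 1 - g 0) \<le> (2 * B2 * (norm v)\<^sup>2) * norm (1 - 0 :: real)"
    proof (rule differentiable_bound[where S = "{0..1}"])
      fix \<tau> :: real assume t: "\<tau> \<in> {0..1}"
      define g' where "g' = (\<lambda>\<sigma>. D (p + \<tau> *\<^sub>R v) (\<sigma> *\<^sub>R v) + D (p + (- \<tau>) *\<^sub>R v) ((- \<sigma>) *\<^sub>R v))"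
      show "(g has_derivative g') (at \<tau> within {0..1})"
        unfolding g_def g'_def using line[OF t, of 1] line[OF t, of "-1"]
        by (auto intro!: has_derivative_add)
      have in_K: "p + \<tau> *\<^sub>R v \<in> K" "p + (- \<tau>) *\<^sub>R v \<in> K" using t seg[of \<tau>] seg[of "- \<tau>"] by auto
      show "onorm g' \<le> 2 * B2 * (norm v)\<^sup>2"
      proof (rule onorm_le)
        fix \<sigma> :: real
        have "linear (D (p + (- \<tau>) *\<^sub>R v))"
          using D in_K K(1) has_derivative_linear by blast
        then have "g' \<sigma> = D (p + \<tau> *\<^sub>R v) (\<sigma> *\<^sub>R v) - D (p + (- \<tau>) *\<^sub>R v) (\<sigma> *\<^sub>R v)"
          unfolding g'_def by (metis add_uminus_conv_diff linear_neg scaleR_minus_left)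
        also have "\<bar>\<dots>\<bar> \<le> B2 * norm ((2 * \<tau>) *\<^sub>R v) * norm (\<sigma> *\<^sub>R v)"
          using Dlip[OF in_K, of "\<sigma> *\<^sub>R v"]
          by (simp add: algebra_simps flip: scaleR_add_left)
        also have "\<dots> \<le> B2 * (2 * norm v) * norm (\<sigma> *\<^sub>R v)"
          using t by (intro mult_right_mono mult_left_mono)
            (auto simp: B2_def mult_left_le_one_le)
        finally show "norm (g' \<sigma>) \<le> 2 * B2 * (norm v)\<^sup>2 * norm \<sigma>"
          by (simp add: power2_eq_square mult_ac)
      qed
    qed auto
    then show ?thesis by (simp add: g_def)
  qed
  define B where "B = \<bar>B0\<bar> + B1 + 2 * B2"
  have le: "B0 \<le> B" "B1 \<le> B" "2 * B2 \<le> B" "0 \<le> B"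
    using B1(1) by (auto simp: B_def B2_def)
  show thesis
  proof
    show "0 \<le> B" by fact
    show "\<bar>f p\<bar> \<le> B" if "p \<in> K" for p using B0[OF that] le by linarith
    show "\<bar>f p - f q\<bar> \<le> B * norm (p - q)" if "p \<in> K" "q \<in> K" for p q
      by (rule order_trans[OF B1(2)[OF that] mult_right_mono[OF le(2)]]) simp
    show "\<bar>f (p + v) + f (p - v) - 2 * f p\<bar> \<le> B * (norm v)\<^sup>2" if "p + v \<in> K" "p - v \<in> K" for p v
      by (rule order_trans[OF B2[OF that] mult_right_mono[OF le(3)]]) simp
  qed
qed

text \<open>The error is grown symmetrically from the midpoint \<open>c\<close>:
  \<open>g 0 = 0\<close>, and \<open>g \<sigma>\<close> is the trapezoidal error. The derivative of
  \<open>g\<close> compares two symmetric sums of \<open>r\<close> about \<open>c\<close>, each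
  within \<open>B * \<sigma>^2\<close> of \<open>2 * r c\<close>. This gives
  \<open>2 * B * \<sigma>^3\<close>, that is \<open>B * s^3 / 4\<close>, which is rounded
  up.\<close>

lemma trapezoid_error:
  fixes u r :: "real \<Rightarrow> real"
  assumes du: "\<And>t. t \<in> {a..a + s} \<Longrightarrow> (u has_real_derivative r t) (at t within {a..a + s})"
    and r2: "\<And>t v. t + v \<in> {a..a + s} \<Longrightarrow> t - v \<in> {a..a + s} \<Longrightarrow> \<bar>r (t + v) + r (t - v) - 2 * r t\<bar> \<le> B * v\<^sup>2"
    and s: "0 \<le> s" and B: "0 \<le> B"
  shows "\<bar>u (a + s) - u a - s / 2 * (r a + r (a + s))\<bar> \<le> B * s ^ 3"
proof -
  define \<sigma> c where "\<sigma> = s / 2" and "c = a + \<sigma>"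
  define g where "g = (\<lambda>\<tau>. u (c + \<tau>) - u (c - \<tau>) - \<tau> * (r a + r (a + s)))"
  have sub: "c + \<tau> \<in> {a..a + s}" "c - \<tau> \<in> {a..a + s}" if "\<tau> \<in> {0..\<sigma>}" for \<tau>
    using that by (auto simp: c_def \<sigma>_def)
  have ends: "c + \<sigma> = a + s" "c - \<sigma> = a" by (auto simp: c_def \<sigma>_def)
  have "norm (g \<sigma> - g 0) \<le> (2 * B * \<sigma>\<^sup>2) * norm (\<sigma> - 0)"
  proof (rule field_differentiable_bound[where S = "{0..\<sigma>}"])
    fix \<tau> assume t: "\<tau> \<in> {0..\<sigma>}"
    have 1: "((\<lambda>\<tau>. u (c + \<tau>)) has_real_derivative r (c + \<tau>) * 1) (at \<tau> within {0..\<sigma>})"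
      by (rule DERIV_image_chain[where g = "\<lambda>\<tau>. c + \<tau>" and f = u, unfolded o_def])
        (auto intro!: derivative_eq_intros DERIV_subset[OF du] simp del: atLeastAtMost_iff image_add_atLeastAtMost image_diff_atLeastAtMost,
         use sub t in \<open>auto simp del: atLeastAtMost_iff image_add_atLeastAtMost image_diff_atLeastAtMost\<close>)
    have 2: "((\<lambda>\<tau>. u (c - \<tau>)) has_real_derivative r (c - \<tau>) * (-1)) (at \<tau> within {0..\<sigma>})"
      by (rule DERIV_image_chain[where g = "\<lambda>\<tau>. c - \<tau>" and f = u, unfolded o_def])
        (auto intro!: derivative_eq_intros DERIV_subset[OF du] simp del: atLeastAtMost_iff image_add_atLeastAtMost image_diff_atLeastAtMost,
         use sub t in \<open>auto simp del: atLeastAtMost_iff image_add_atLeastAtMost image_diff_atLeastAtMost\<close>)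
    show "(g has_real_derivative (r (c + \<tau>) + r (c - \<tau>) - (r a + r (a + s)))) (at \<tau> within {0..\<sigma>})"
      unfolding g_def by (auto intro!: derivative_eq_intros 1[simplified] 2[simplified])
    have "\<bar>r (c + \<tau>) + r (c - \<tau>) - 2 * r c\<bar> \<le> B * \<tau>\<^sup>2"
      by (intro r2 sub t)
    also have "\<dots> \<le> B * \<sigma>\<^sup>2"
      using t B by (intro mult_left_mono power_mono) auto
    finally have "\<bar>r (c + \<tau>) + r (c - \<tau>) - 2 * r c\<bar> \<le> B * \<sigma>\<^sup>2" .
    moreover have "\<bar>r (c + \<sigma>) + r (c - \<sigma>) - 2 * r c\<bar> \<le> B * \<sigma>\<^sup>2"
      using t by (intro r2 sub) auto
    ultimately show "norm (r (c + \<tau>) + r (c - \<tau>) - (r a + r (a + s))) \<le> 2 * B * \<sigma>\<^sup>2"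
      by (simp add: ends)
  qed (use s in \<open>auto simp: \<sigma>_def\<close>)
  then have "\<bar>u (a + s) - u a - s / 2 * (r a + r (a + s))\<bar> \<le> 2 * B * \<sigma>\<^sup>2 * \<sigma>"
    using s by (simp add: g_def ends) (simp add: \<sigma>_def algebra_simps add_divide_distrib)
  also have "\<dots> \<le> B * s ^ 3"
    using B s by (simp add: \<sigma>_def power2_eq_square power3_eq_cube mult_left_le)
  finally show ?thesis .
qed

subsection \<open>Quadrature of periodic functions\<close>

lemma periodic_shift:
  assumes "periodic L1 L2 f"
  shows "f (x1 + of_int a * L1, x2 + of_int b * L2) = f (x1, x2)"
proof -
  have 1: "f (x1 + of_int a * L1, x2) = f (x1, x2)" for x1 x2
  proof (induction a arbitrary: x1 rule: int_induct[where k = 0])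
    case (step1 i)
    show ?case using step1(2)[of "x1 + L1"] assms[unfolded periodic_def, rule_format, of x1 x2]
      by (simp add: algebra_simps)
  next
    case (step2 i)
    show ?case using step2(2)[of "x1 - L1"] assms[unfolded periodic_def, rule_format, of "x1 - L1" x2]
      by (simp add: algebra_simps)
  qed simp
  have 2: "f (x1, x2 + of_int b * L2) = f (x1, x2)" for x1 x2
  proof (induction b arbitrary: x2 rule: int_induct[where k = 0])
    case (step1 i)
    show ?case using step1(2)[of "x2 + L2"] assms[unfolded periodic_def, rule_format, of x1 x2]
      by (simp add: algebra_simps)
  next
    case (step2 i)
    show ?case using step2(2)[of "x2 - L2"] assms[unfolded periodic_def, rule_format, of x1 "x2 - L2"]
      by (simp add: algebra_simps)
  qed simp
  show ?thesis using 1 2 by simp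
qed

text \<open>Transfers bounds on a compact box to the whole plane. The shift \<open>d\<close> depends
  on \<open>x\<close> alone, so it serves every periodic function and also the points neighbouring
  \<open>x\<close>.\<close>

lemma periodic_representative:
  fixes x :: "real \<times> real"
  assumes "0 < L1" "0 < L2"
  obtains d where "x + d \<in> cbox 0 (L1, L2)" "\<And>f y. periodic L1 L2 f \<Longrightarrow> f (y + d) = f y"
proof
  define d where "d = (of_int (- \<lfloor>fst x / L1\<rfloor>) * L1, of_int (- \<lfloor>snd x / L2\<rfloor>) * L2)"
  have *: "0 \<le> a + of_int (- \<lfloor>a / L\<rfloor>) * L \<and> a + of_int (- \<lfloor>a / L\<rfloor>) * L \<le> L" if "0 < L" for a L :: real
  proof -
    have "of_int \<lfloor>a / L\<rfloor> * L \<le> a / L * L" "a / L * L \<le> (of_int \<lfloor>a / L\<rfloor> + 1) * L"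
      using that by (intro mult_right_mono; linarith)+
    then show ?thesis using that by (simp add: algebra_simps)
  qed
  show "x + d \<in> cbox 0 (L1, L2)"
    using *[OF assms(1), of "fst x"] *[OF assms(2), of "snd x"]
    by (cases x) (simp add: d_def zero_prod_def)
  show "f (y + d) = f y" if "periodic L1 L2 f" for f y
    using periodic_shift[OF that] by (cases y) (simp add: d_def del: of_int_minus)
qed

lemma sum_periodic_shift:
  fixes f :: "int \<Rightarrow> 'a::comm_monoid_add"
  assumes "\<And>k. f (k + int m) = f k"
  shows "(\<Sum>k=1..int m. f (k - 1)) = (\<Sum>k=1..int m. f k)"
proof (cases "m = 0")
  case False
  have "(\<Sum>k=1..int m. f (k - 1)) = (\<Sum>k=0..int m - 1. f k)"
    by (rule sum.reindex_bij_witness[of _ "\<lambda>k. k + 1" "\<lambda>k. k - 1"]) auto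
  also have "{0..int m - 1} = insert 0 {1..int m - 1}" using False by auto
  also have "sum f (insert 0 {1..int m - 1}) = f 0 + sum f {1..int m - 1}" by simp
  also have "f 0 = f (int m)" using assms[of 0] by simp
  also have "f (int m) + sum f {1..int m - 1} = sum f (insert (int m) {1..int m - 1})" by simp
  also have "insert (int m) {1..int m - 1} = {1..int m}" using False by auto
  finally show ?thesis .
qed simp

lemma box_real_Pair: "box (a, c) (b, d) = box a b \<times> box c (d :: real)" for a b :: real
  by (auto simp: box_def Basis_prod_def)

lemma Omega_eq_box: "Omega L1 L2 = box 0 (L1, L2)"
  by (simp add: Omega_def zero_prod_def box_real_Pair)

lemma integral_Omega: "integral (Omega L1 L2) f = integral (cbox 0 (L1, L2)) (f :: _ \<Rightarrow> real)"
  by (simp add: Omega_eq_box integral_open_interval)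

lemma Union_grid_cells:
  fixes h :: real
  assumes "0 < h" "0 < m" "0 < n"
  shows "(\<Union>(k, l)\<in>{1..int m} \<times> {1..int n}.
            cbox (of_int (k - 1) * h, of_int (l - 1) * h) (of_int k * h, of_int l * h))
         = cbox 0 (real m * h, real n * h)" (is "?U = ?C")
proof
  show "?U \<subseteq> ?C"
  proof (clarsimp simp: zero_prod_def)
    fix k l :: int and a b :: real
    assume kl: "1 \<le> k" "k \<le> int m" "1 \<le> l" "l \<le> int n"
      and ab: "(of_int k - 1) * h \<le> a" "a \<le> of_int k * h" "(of_int l - 1) * h \<le> b" "b \<le> of_int l * h"
    have "0 \<le> (of_int k - 1) * h" "0 \<le> (of_int l - 1) * h"
      "of_int k * h \<le> real m * h" "of_int l * h \<le> real n * h"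
      using kl assms by (auto intro!: mult_nonneg_nonneg mult_right_mono)
    then show "0 \<le> a \<and> a \<le> real m * h \<and> 0 \<le> b \<and> b \<le> real n * h" using ab by linarith
  qed
next
  have *: "\<exists>k\<in>{1..int q}. of_int (k - 1) * h \<le> a \<and> a \<le> of_int k * h"
    if "0 \<le> a" "a \<le> real q * h" "0 < q" for a q
  proof
    \<comment> \<open>The ceiling alone would give index 0 on the edge \<open>a = 0\<close>; the
      maximum assigns that edge to the first cell.\<close>
    let ?k = "max 1 \<lceil>a / h\<rceil>"
    have "a / h \<le> real q" using that assms by (simp add: field_simps)
    then show "?k \<in> {1..int q}" using that by (auto simp: ceiling_le_iff)
    have "of_int (?k - 1) * h \<le> (a / h) * h"
    proof (rule mult_right_mono)
      show "of_int (?k - 1) \<le> a / h" using that assms by (auto simp: max_def)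
    qed (use assms in simp)
    moreover have "(a / h) * h \<le> of_int ?k * h"
    proof (rule mult_right_mono)
      show "a / h \<le> of_int ?k" by (rule order_trans[OF le_of_int_ceiling]) simp
    qed (use assms in simp)
    ultimately show "of_int (?k - 1) * h \<le> a \<and> a \<le> of_int ?k * h"
      using assms by simp
  qed
  show "?C \<subseteq> ?U"
  proof
    fix x assume "x \<in> ?C"
    then obtain a b where x: "x = (a, b)" and ab: "0 \<le> a" "a \<le> real m * h" "0 \<le> b" "b \<le> real n * h"
      by (cases x) (auto simp: zero_prod_def)
    obtain k l where "k\<in>{1..int m}" "of_int (k - 1) * h \<le> a \<and> a \<le> of_int k * h"
      "l\<in>{1..int n}" "of_int (l - 1) * h \<le> b \<and> b \<le> of_int l * h"
      using *[OF ab(1,2) assms(2)] *[OF ab(3,4) assms(3)] by blast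
    then show "x \<in> ?U" by (intro UN_I[of "(k, l)"]) (auto simp: x)
  qed
qed

text \<open>Closed cells may share edges. A point interior to two cells determines both indices, so
  distinct cells meet in a convex set with empty interior, which is negligible.\<close>

lemma negligible_Int_grid_cells:
  fixes h :: real
  assumes "0 < h" "(k, l) \<noteq> (k', l')"
  shows "negligible (cbox (of_int (k - 1) * h, of_int (l - 1) * h) (of_int k * h, of_int l * h)
           \<inter> cbox (of_int (k' - 1) * h, of_int (l' - 1) * h) (of_int k' * h, of_int l' * h))"
    (is "negligible (?A \<inter> ?B)")
proof -
  have one: "k = k'" if "of_int (k - 1) * h < a" "a < of_int k * h" "of_int (k' - 1) * h < a" "a < of_int k' * h"
    for k k' :: int and a
  proof -
    have "of_int (k - 1) * h < of_int k' * h" "of_int (k' - 1) * h < of_int k * h"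
      using that by linarith+
    then have "k - 1 < k'" "k' - 1 < k"
      using assms(1) by (auto simp only: mult_less_cancel_right_pos of_int_less_iff)
    then show ?thesis by linarith
  qed
  have "interior (?A \<inter> ?B) = {}"
    using assms(2) one by (auto simp: box_real_Pair simp del: of_int_diff)
  then show ?thesis
    by (subst negligible_convex_interior) (auto intro: convex_Int convex_box)
qed

text \<open>Summing over the nodes turns the composite rule into a one-cell quadrature of an
  \<open>h\<close>-periodic function; its integral over the cell is invariant under \<open>y \<mapsto> -y\<close>, so only the
  symmetric second difference about the node enters the error.\<close>

lemma periodic_quadrature_error:
  fixes g :: "real \<times> real \<Rightarrow> real"
  assumes cont: "continuous_on UNIV g" and per: "periodic L1 L2 g"
    and L: "L1 = real m * h" "L2 = real n * h" and pos: "0 < h" "0 < m" "0 < n" and K: "0 \<le> K"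
    and second: "\<And>c v. v \<in> cbox 0 (h, h) \<Longrightarrow> \<bar>g (c + v) + g (c - v) - 2 * g c\<bar> \<le> K * (norm v)\<^sup>2"
  shows "\<bar>h\<^sup>2 * (\<Sum>k=1..int m. \<Sum>l=1..int n. g (of_int k * h, of_int l * h)) - integral (Omega L1 L2) g\<bar>
           \<le> K * (L1 * L2) * h\<^sup>2"
proof -
  define node where "node = (\<lambda>k l :: int. (of_int k * h, of_int l * h))"
  define G where "G = (\<lambda>y. \<Sum>k=1..int m. \<Sum>l=1..int n. g (y + node k l))"
  define Q where "Q = cbox 0 (h, h)"
  have contg: "continuous_on S (\<lambda>y. g (a y))" if "continuous_on S a" for S :: "(real \<times> real) set" and a
    using continuous_on_compose2[OF cont that] by simp
  have contG: "continuous_on S (\<lambda>y. G (a y))" if "continuous_on S a" for S :: "(real \<times> real) set" and a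
    unfolding G_def by (intro continuous_intros contg that)
  have perk: "g (y + node (k + int m) l) = g (y + node k l)"
    and perl: "g (y + node k (l + int n)) = g (y + node k l)" for y k l
    using periodic_shift[OF per, of "fst y + of_int k * h" 1 "snd y + of_int l * h" 0]
      periodic_shift[OF per, of "fst y + of_int k * h" 0 "snd y + of_int l * h" 1]
    by (cases y, simp add: node_def L algebra_simps)+
  \<comment> \<open>Translating a cell to \<open>Q\<close> uses its lower-left node, whose indices
    are one less than those of the cell; periodicity absorbs this offset.\<close>
  have shift: "(\<Sum>k=1..int m. \<Sum>l=1..int n. g (y + node (k - 1) (l - 1))) = G y" for y
  proof -
    have "(\<Sum>l=1..int n. g (y + node k (l - 1))) = (\<Sum>l=1..int n. g (y + node k l))" for k
      by (rule sum_periodic_shift[of "\<lambda>l. g (y + node k l)"]) (simp add: perl)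
    then have "(\<Sum>k=1..int m. \<Sum>l=1..int n. g (y + node (k - 1) (l - 1)))
        = (\<Sum>k=1..int m. \<Sum>l=1..int n. g (y + node (k - 1) l))" by simp
    also have "\<dots> = G y"
      unfolding G_def
      by (rule sum_periodic_shift[of "\<lambda>k. \<Sum>l=1..int n. g (y + node k l)"]) (simp add: perk)
    finally show ?thesis .
  qed
  have Gper: "G (y + (h, h)) = G y" for y
  proof -
    have "G (y + (h, h)) = (\<Sum>k=1..int m. \<Sum>l=1..int n. g (y + (h, h) + node (k - 1) (l - 1)))"
      by (simp add: shift)
    also have "\<dots> = G y"
      unfolding G_def node_def by (cases y) (simp add: algebra_simps)
    finally show ?thesis .
  qed
  define cell where "cell = (\<lambda>(k, l). cbox (node (k - 1) (l - 1)) (node k l))"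
  have "(g has_integral (\<Sum>p\<in>{1..int m} \<times> {1..int n}. integral (cell p) g))
      (\<Union>p\<in>{1..int m} \<times> {1..int n}. cell p)"
  proof (rule has_integral_UN)
    show "(g has_integral integral (cell p) g) (cell p)" for p
      unfolding cell_def
      by (cases p) (auto intro!: integrable_integral integrable_continuous continuous_on_subset[OF cont])
    show "pairwise (\<lambda>i i'. negligible (cell i \<inter> cell i')) ({1..int m} \<times> {1..int n})"
      unfolding pairwise_def cell_def node_def using negligible_Int_grid_cells[OF pos(1)]
      by (auto simp del: of_int_diff)
  qed auto
  moreover have "(\<Union>p\<in>{1..int m} \<times> {1..int n}. cell p) = cbox 0 (L1, L2)"
    unfolding cell_def node_def L using Union_grid_cells[OF pos] by simp
  ultimately have "integral (Omega L1 L2) g = (\<Sum>p\<in>{1..int m} \<times> {1..int n}. integral (cell p) g)"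
    by (simp add: integral_Omega integral_unique)
  also have "\<dots> = (\<Sum>p\<in>{1..int m} \<times> {1..int n}.
                      integral Q (\<lambda>y. g (y + node (fst p - 1) (snd p - 1))))"
  proof (rule sum.cong[OF refl])
    fix p :: "int \<times> int"
    obtain k l where p: "p = (k, l)" by (cases p)
    have "node k l - node (k - 1) (l - 1) = (h, h)" "node (k - 1) (l - 1) - node (k - 1) (l - 1) = 0"
      by (auto simp: node_def algebra_simps zero_prod_def)
    with integral_shift_cbox[of "node (k - 1) (l - 1)" "node (k - 1) (l - 1)" "node k l" g]
    show "integral (cell p) g = integral Q (\<lambda>y. g (y + node (fst p - 1) (snd p - 1)))"
      by (simp add: p cell_def Q_def)
  qed
  also have "\<dots> = integral Q (\<lambda>y. \<Sum>p\<in>{1..int m} \<times> {1..int n}. g (y + node (fst p - 1) (snd p - 1)))"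
    by (subst integral_sum)
      (auto simp: Q_def intro!: integrable_continuous contg continuous_intros)
  also have "\<dots> = integral Q G"
    by (simp add: sum.cartesian_product' shift cong: sum.cong)
  finally have int_G: "integral (Omega L1 L2) g = integral Q G" .
  \<comment> \<open>Reflection carries \<open>Q\<close> to the cell on the opposite side of the
    origin, and the diagonal shift \<open>(h, h)\<close>, under which \<open>G\<close> is invariant,
    brings it back.\<close>
  have int_G': "integral (Omega L1 L2) g = integral Q (\<lambda>y. G (- y))"
    using integral_reflect[of 0 "- (h, h)" G] integral_shift_cbox[of 0 "(h, h)" "(h, h)" G]
    by (simp add: Q_def int_G Gper)
  have G0: "G 0 = (\<Sum>k=1..int m. \<Sum>l=1..int n. g (of_int k * h, of_int l * h))"
    by (simp add: G_def node_def zero_prod_def)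
  have content: "measure lborel Q = h\<^sup>2"
    using pos by (simp add: Q_def zero_prod_def content_Pair power2_eq_square)
  let ?R = "\<lambda>y. G y + G (- y) - 2 * G 0"
  have intG: "G integrable_on Q" "(\<lambda>y. G (- y)) integrable_on Q"
    unfolding Q_def by (intro integrable_continuous contG continuous_intros)+
  \<comment> \<open>Adding both forms of the integral gives twice the quadrature error, with a
    symmetric second difference of \<open>G\<close> about the origin as integrand.\<close>
  have "((\<lambda>y. G y + G (- y) - 2 * G 0) has_integral
      (integral (Omega L1 L2) g + integral (Omega L1 L2) g - measure lborel Q *\<^sub>R (2 * G 0))) Q"
  proof (intro has_integral_diff has_integral_add)
    show "(G has_integral integral (Omega L1 L2) g) Q"
      using integrable_integral[OF intG(1)] by (simp add: int_G)
    show "((\<lambda>y. G (- y)) has_integral integral (Omega L1 L2) g) Q"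
      using integrable_integral[OF intG(2)] by (simp add: int_G')
  qed (unfold Q_def, rule has_integral_const)
  then have "norm (integral (Omega L1 L2) g + integral (Omega L1 L2) g - measure lborel Q *\<^sub>R (2 * G 0))
      \<le> (real m * real n * (K * (2 * h\<^sup>2))) * measure lborel Q"
    unfolding Q_def
  proof (rule has_integral_bound[rotated])
    show "0 \<le> real m * real n * (K * (2 * h\<^sup>2))" using K by simp
    fix y assume y: "y \<in> cbox 0 (h, h)"
    have ny: "(norm y)\<^sup>2 \<le> 2 * h\<^sup>2"
    proof (cases y)
      case (Pair a b)
      then have "a\<^sup>2 \<le> h\<^sup>2" "b\<^sup>2 \<le> h\<^sup>2" using y by (auto simp: zero_prod_def intro: power_mono)
      then show ?thesis by (simp add: Pair norm_Pair)
    qed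
    have "?R y = (\<Sum>k=1..int m. \<Sum>l=1..int n. g (node k l + y) + g (node k l - y) - 2 * g (node k l))"
      by (simp add: G_def sum.distrib sum_subtractf sum_distrib_left add.commute)
    also have "\<bar>\<dots>\<bar> \<le> (\<Sum>k=1..int m. \<Sum>l=1..int n. K * (2 * h\<^sup>2))"
      by (rule order_trans[OF sum_abs], intro sum_mono, rule order_trans[OF sum_abs], intro sum_mono,
        rule order_trans[OF second[OF y]], intro mult_left_mono ny K)
    finally show "norm (?R y) \<le> real m * real n * (K * (2 * h\<^sup>2))" by simp
  qed
  then have "\<bar>2 * (h\<^sup>2 * G 0 - integral (Omega L1 L2) g)\<bar> \<le> 2 * (K * (L1 * L2) * h\<^sup>2)"
    by (simp add: content L power2_eq_square algebra_simps abs_minus_commute)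
  then show ?thesis by (simp add: G0 abs_mult)
qed

subsection \<open>Periodic functions with bounded second differences\<close>

text \<open>A derivative-free substitute for a C2 bound, stated in the form the quadrature consumes.
  Displacements have nonnegative components of at most \<open>R\<close>, as those inside a cell do;
  since that box is not symmetric, both \<open>c + v\<close> and \<open>c - v\<close> are
  listed.\<close>

definition C2_bounded :: "real \<Rightarrow> real \<times> real \<Rightarrow> (real \<times> real \<Rightarrow> real) \<Rightarrow> bool" where
  "C2_bounded B R f \<longleftrightarrow> continuous_on UNIV f \<and> (\<forall>c. \<bar>f c\<bar> \<le> B) \<and>
     (\<forall>c. \<forall>v\<in>cbox 0 R. \<bar>f (c + v) - f c\<bar> \<le> B * norm v \<and> \<bar>f (c - v) - f c\<bar> \<le> B * norm v \<and>
        \<bar>f (c + v) + f (c - v) - 2 * f c\<bar> \<le> B * (norm v)\<^sup>2)"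

lemma C2_boundedD:
  assumes "C2_bounded B R f"
  shows "continuous_on UNIV f" "\<bar>f c\<bar> \<le> B" "0 \<le> B"
    "v \<in> cbox 0 R \<Longrightarrow> \<bar>f (c + v) - f c\<bar> \<le> B * norm v"
    "v \<in> cbox 0 R \<Longrightarrow> \<bar>f (c - v) - f c\<bar> \<le> B * norm v"
    "v \<in> cbox 0 R \<Longrightarrow> \<bar>f (c + v) + f (c - v) - 2 * f c\<bar> \<le> B * (norm v)\<^sup>2"
  using assms order_trans[OF abs_ge_zero] unfolding C2_bounded_def by blast+

lemma C2_bounded_const: "\<bar>a\<bar> \<le> B \<Longrightarrow> C2_bounded B R (\<lambda>_. a)"
  by (simp add: C2_bounded_def)

lemma C2_bounded_mono:
  assumes "C2_bounded A R f" "A \<le> B"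
  shows "C2_bounded B R f"
proof -
  have "A * norm v \<le> B * norm v" "A * (norm v)\<^sup>2 \<le> B * (norm v)\<^sup>2" for v :: "real \<times> real"
    by (intro mult_right_mono assms zero_le_power2 norm_ge_zero)+
  then show ?thesis using assms unfolding C2_bounded_def by (meson order_trans)
qed

lemma C2_bounded_diff:
  assumes "C2_bounded A R f" "C2_bounded B R g"
  shows "C2_bounded (A + B) R (\<lambda>x. f x - g x)"
proof -
  have "continuous_on UNIV (\<lambda>x. f x - g x)"
    by (intro continuous_on_diff C2_boundedD[OF assms(1)] C2_boundedD[OF assms(2)])
  moreover have "\<bar>f c - g c\<bar> \<le> A + B" for c
    using C2_boundedD(2)[OF assms(1), of c] C2_boundedD(2)[OF assms(2), of c] by linarith
  moreover have "\<bar>f (c + v) - g (c + v) - (f c - g c)\<bar> \<le> (A + B) * norm v"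
    "\<bar>f (c - v) - g (c - v) - (f c - g c)\<bar> \<le> (A + B) * norm v"
    "\<bar>f (c + v) - g (c + v) + (f (c - v) - g (c - v)) - 2 * (f c - g c)\<bar> \<le> (A + B) * (norm v)\<^sup>2"
    if "v \<in> cbox 0 R" for c v
    using add_mono[OF C2_boundedD(4)[OF assms(1) that, of c] C2_boundedD(4)[OF assms(2) that, of c]]
      add_mono[OF C2_boundedD(5)[OF assms(1) that, of c] C2_boundedD(5)[OF assms(2) that, of c]]
      add_mono[OF C2_boundedD(6)[OF assms(1) that, of c] C2_boundedD(6)[OF assms(2) that, of c]]
    by (auto simp: distrib_right abs_le_iff)
  ultimately show ?thesis by (auto simp: C2_bounded_def)
qed

text \<open>Periodicity moves the base point \<open>c\<close> into one period; a displacement by at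
  most one period in either direction then stays in the box from \<open>- (L1, L2)\<close> to twice
  \<open>(L1, L2)\<close>, so bounds on that compact box suffice.\<close>

lemma C2_bounded_periodicI:
  assumes L: "0 < L1" "0 < L2" and per: "periodic L1 L2 f" and cont: "continuous_on UNIV f"
    and bd: "\<And>p. p \<in> cbox (- (L1, L2)) (2 *\<^sub>R (L1, L2)) \<Longrightarrow> \<bar>f p\<bar> \<le> B"
      "\<And>p q. p \<in> cbox (- (L1, L2)) (2 *\<^sub>R (L1, L2)) \<Longrightarrow> q \<in> cbox (- (L1, L2)) (2 *\<^sub>R (L1, L2)) \<Longrightarrow>
         \<bar>f p - f q\<bar> \<le> B * norm (p - q)"
      "\<And>p v. p + v \<in> cbox (- (L1, L2)) (2 *\<^sub>R (L1, L2)) \<Longrightarrow> p - v \<in> cbox (- (L1, L2)) (2 *\<^sub>R (L1, L2)) \<Longrightarrow>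
         \<bar>f (p + v) + f (p - v) - 2 * f p\<bar> \<le> B * (norm v)\<^sup>2"
  shows "C2_bounded B (L1, L2) f"
proof -
  let ?K = "cbox (- (L1, L2)) (2 *\<^sub>R (L1, L2))"
  have "\<bar>f c\<bar> \<le> B" for c
  proof -
    obtain d where "c + d \<in> cbox 0 (L1, L2)" and d: "\<And>y. f (y + d) = f y"
      using periodic_representative[OF L, of c] per by metis
    then have "c + d \<in> ?K" using L by (cases "c + d") (auto simp: zero_prod_def)
    from bd(1)[OF this] show ?thesis by (simp add: d)
  qed
  moreover have "\<bar>f (c + v) - f c\<bar> \<le> B * norm v \<and> \<bar>f (c - v) - f c\<bar> \<le> B * norm v \<and>
        \<bar>f (c + v) + f (c - v) - 2 * f c\<bar> \<le> B * (norm v)\<^sup>2" if v: "v \<in> cbox 0 (L1, L2)" for c v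
  proof -
    obtain d where cd: "c + d \<in> cbox 0 (L1, L2)" and d: "\<And>y. f (y + d) = f y"
      using periodic_representative[OF L, of c] per by metis
    have K: "c + d \<in> ?K" "c + d + v \<in> ?K" "c + d - v \<in> ?K"
      using L cd v by (cases "c + d"; cases v; auto simp: zero_prod_def)+
    have eq: "f (c + d) = f c" "f (c + d + v) = f (c + v)" "f (c + d - v) = f (c - v)"
      using d[of c] d[of "c + v"] d[of "c - v"] by (simp_all add: algebra_simps)
    show ?thesis
      using bd(2)[OF K(2,1)] bd(2)[OF K(3,1)] bd(3)[OF K(2,3)] by (simp add: eq)
  qed
  ultimately show ?thesis using cont by (simp add: C2_bounded_def)
qed

lemma Cinf_per_C2_bounded:
  assumes L: "0 < L1" "0 < L2" and f: "Cinf_per L1 L2 f"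
  obtains B where "C2_bounded B (L1, L2) f"
proof -
  have C2: "Ck_on 2 f UNIV" and per: "periodic L1 L2 f"
    using f by (auto simp: Cinf_per_def smooth_on_def)
  show thesis
  proof (rule second_difference_bound[OF C2, of "cbox (- (L1, L2)) (2 *\<^sub>R (L1, L2))"])
    fix B
    assume "\<And>p. p \<in> cbox (- (L1, L2)) (2 *\<^sub>R (L1, L2)) \<Longrightarrow> \<bar>f p\<bar> \<le> B"
      "\<And>p q. p \<in> cbox (- (L1, L2)) (2 *\<^sub>R (L1, L2)) \<Longrightarrow> q \<in> cbox (- (L1, L2)) (2 *\<^sub>R (L1, L2)) \<Longrightarrow>
         \<bar>f p - f q\<bar> \<le> B * norm (p - q)"
      "\<And>p v. p + v \<in> cbox (- (L1, L2)) (2 *\<^sub>R (L1, L2)) \<Longrightarrow> p - v \<in> cbox (- (L1, L2)) (2 *\<^sub>R (L1, L2)) \<Longrightarrow>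
         \<bar>f (p + v) + f (p - v) - 2 * f p\<bar> \<le> B * (norm v)\<^sup>2"
    then have "C2_bounded B (L1, L2) f"
      by (intro C2_bounded_periodicI L per Ck_on_imp_continuous_on[OF C2])
    then show thesis by (rule that)
  qed auto
qed

text \<open>One application of \<open>second_difference_bound\<close> in space-time yields
  everything: displacements \<open>(v, 0)\<close> give the spatial bounds,
  \<open>(0, \<sigma>)\<close> the temporal ones. Periodicity extends them from a compact box to all
  \<open>x\<close>.\<close>

lemma smooth_evolution_bounds:
  fixes \<Phi> :: "real \<times> real \<Rightarrow> real \<Rightarrow> real"
  assumes L: "0 < L1" "0 < L2" and C2: "Ck_on 2 (\<lambda>(x, t). \<Phi> x t) (UNIV \<times> {0..T})"
    and per: "\<And>t. t \<in> {0..T} \<Longrightarrow> periodic L1 L2 (\<lambda>x. \<Phi> x t)"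
  obtains B where "\<And>t. t \<in> {0..T} \<Longrightarrow> C2_bounded B (L1, L2) (\<lambda>x. \<Phi> x t)"
    "\<And>x t t'. t \<in> {0..T} \<Longrightarrow> t' \<in> {0..T} \<Longrightarrow> \<bar>\<Phi> x t - \<Phi> x t'\<bar> \<le> B * \<bar>t - t'\<bar>"
    "\<And>x t \<sigma>. t + \<sigma> \<in> {0..T} \<Longrightarrow> t - \<sigma> \<in> {0..T} \<Longrightarrow> \<bar>\<Phi> x (t + \<sigma>) + \<Phi> x (t - \<sigma>) - 2 * \<Phi> x t\<bar> \<le> B * \<sigma>\<^sup>2"
proof -
  let ?K = "cbox (- (L1, L2)) (2 *\<^sub>R (L1, L2))"
  obtain B where
    B1: "\<And>p. p \<in> ?K \<times> {0..T} \<Longrightarrow> \<bar>case p of (x, t) \<Rightarrow> \<Phi> x t\<bar> \<le> B" and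
    B2: "\<And>p q. p \<in> ?K \<times> {0..T} \<Longrightarrow> q \<in> ?K \<times> {0..T} \<Longrightarrow>
        \<bar>(case p of (x, t) \<Rightarrow> \<Phi> x t) - (case q of (x, t) \<Rightarrow> \<Phi> x t)\<bar> \<le> B * norm (p - q)" and
    B3: "\<And>p v. p + v \<in> ?K \<times> {0..T} \<Longrightarrow> p - v \<in> ?K \<times> {0..T} \<Longrightarrow>
        \<bar>(case p + v of (x, t) \<Rightarrow> \<Phi> x t) + (case p - v of (x, t) \<Rightarrow> \<Phi> x t)
          - 2 * (case p of (x, t) \<Rightarrow> \<Phi> x t)\<bar> \<le> B * (norm v)\<^sup>2"
    by (rule second_difference_bound[OF C2, of "?K \<times> {0..T}"])
      (auto intro!: compact_Times convex_Times)
  show thesis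
  proof
    fix t assume t: "t \<in> {0..T}"
    have "continuous_on UNIV (\<lambda>x. case (x, t) of (x, t) \<Rightarrow> \<Phi> x t)"
      by (rule continuous_on_compose2[OF Ck_on_imp_continuous_on[OF C2]])
        (use t in \<open>auto intro!: continuous_intros\<close>)
    then have cont: "continuous_on UNIV (\<lambda>x. \<Phi> x t)" by simp
    show "C2_bounded B (L1, L2) (\<lambda>x. \<Phi> x t)"
    proof (rule C2_bounded_periodicI[OF L per[OF t] cont])
      show "\<bar>\<Phi> p t\<bar> \<le> B" if "p \<in> ?K" for p using B1[of "(p, t)"] that t by simp
      show "\<bar>\<Phi> p t - \<Phi> q t\<bar> \<le> B * norm (p - q)" if "p \<in> ?K" "q \<in> ?K" for p q
        using B2[of "(p, t)" "(q, t)"] that t by (simp add: norm_Pair)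
      show "\<bar>\<Phi> (p + v) t + \<Phi> (p - v) t - 2 * \<Phi> p t\<bar> \<le> B * (norm v)\<^sup>2" if "p + v \<in> ?K" "p - v \<in> ?K" for p v
        using B3[of "(p, t)" "(v, 0)"] that t by (simp add: norm_Pair)
    qed
  next
    fix x t t' assume t: "t \<in> {0..T}" "t' \<in> {0..T}"
    obtain d where xd: "x + d \<in> cbox 0 (L1, L2)" and d: "\<And>t. t \<in> {0..T} \<Longrightarrow> \<Phi> (x + d) t = \<Phi> x t"
      using periodic_representative[OF L, of x] per by metis
    have "x + d \<in> ?K" using L xd by (cases "x + d") (auto simp: zero_prod_def)
    then show "\<bar>\<Phi> x t - \<Phi> x t'\<bar> \<le> B * \<bar>t - t'\<bar>"
      using B2[of "(x + d, t)" "(x + d, t')"] t by (simp add: norm_Pair d)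
  next
    fix x t \<sigma> assume t: "t + \<sigma> \<in> {0..T}" "t - \<sigma> \<in> {0..T}"
    then have t': "t \<in> {0..T}" by auto
    obtain d where xd: "x + d \<in> cbox 0 (L1, L2)" and d: "\<And>t. t \<in> {0..T} \<Longrightarrow> \<Phi> (x + d) t = \<Phi> x t"
      using periodic_representative[OF L, of x] per by metis
    have "x + d \<in> ?K" using L xd by (cases "x + d") (auto simp: zero_prod_def)
    then show "\<bar>\<Phi> x (t + \<sigma>) + \<Phi> x (t - \<sigma>) - 2 * \<Phi> x t\<bar> \<le> B * \<sigma>\<^sup>2"
      using B3[of "(x + d, t)" "(0, \<sigma>)"] t by (simp add: norm_Pair d[OF t(1)] d[OF t(2)] d[OF t'])
  qed
qed

text \<open>The rate \<open>R\<close> is identified with the time component of the space-time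
  derivative, so it inherits two orders of smoothness from \<open>\<Phi>\<close> and the equation
  never has to be differentiated. The set \<open>X\<close> lies in a compact box, which makes
  \<open>B\<close> uniform in \<open>x\<close>.\<close>

lemma smooth_evolution_trapezoid:
  fixes \<Phi> :: "real \<times> real \<Rightarrow> real \<Rightarrow> real"
  assumes C3: "Ck_on 3 (\<lambda>(x, t). \<Phi> x t) (UNIV \<times> {0..T})" and T: "0 < T"
    and X: "X \<subseteq> cbox a b"
    and deriv: "\<And>x t. x \<in> X \<Longrightarrow> t \<in> {0..T} \<Longrightarrow>
        ((\<lambda>\<tau>. \<Phi> x \<tau>) has_real_derivative R x t) (at t within {0..T})"
  obtains B where "0 \<le> B"
    "\<And>x t s. x \<in> X \<Longrightarrow> 0 \<le> t \<Longrightarrow> 0 \<le> s \<Longrightarrow> t + s \<le> T \<Longrightarrow>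
        \<bar>\<Phi> x (t + s) - \<Phi> x t - s / 2 * (R x t + R x (t + s))\<bar> \<le> B * s ^ 3"
proof -
  let ?S = "UNIV \<times> {0..T}" and ?K = "cbox a b \<times> {0..T}"
  obtain D where D: "\<And>p. p \<in> ?S \<Longrightarrow> ((\<lambda>(x, t). \<Phi> x t) has_derivative D p) (at p within ?S)"
    and D2: "\<And>v. Ck_on 2 (\<lambda>p. D p v) ?S"
    using C3 by (auto simp: numeral_3_eq_3 numeral_2_eq_2)
  \<comment> \<open>Derivatives within the nondegenerate interval \<open>{0..T}\<close> are unique,
    also at its end points.\<close>
  have R: "D (x, t) (0, 1) = R x t" if x: "x \<in> X" and t: "t \<in> {0..T}" for x t
  proof -
    have "((\<lambda>\<tau>. case (x, \<tau>) of (x, t) \<Rightarrow> \<Phi> x t) has_derivative (\<lambda>\<sigma>. D (x, t) (0, \<sigma>))) (at t within {0..T})"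
      by (rule has_derivative_in_compose2[OF D])
        (use t in \<open>auto intro!: derivative_eq_intros\<close>)
    moreover have "(\<lambda>\<sigma>. D (x, t) (0, \<sigma>)) = (\<lambda>\<sigma>. \<sigma> *\<^sub>R D (x, t) (0, 1))"
    proof
      fix \<sigma> :: real
      have "linear (D (x, t))" using has_derivative_linear[OF D[of "(x, t)"]] t by simp
      from linear_scale[OF this, of \<sigma> "(0, 1)"]
      show "D (x, t) (0, \<sigma>) = \<sigma> *\<^sub>R D (x, t) (0, 1)"
        unfolding scaleR_Pair scaleR_zero_right real_scaleR_def mult_1_right .
    qed
    ultimately have "(\<Phi> x has_vector_derivative D (x, t) (0, 1)) (at t within {0..T})"
      by (simp only: has_vector_derivative_def prod.case)
    moreover have "(\<Phi> x has_vector_derivative R x t) (at t within {0..T})"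
      using deriv[OF x t] by (simp add: has_real_derivative_iff_has_vector_derivative)
    ultimately show ?thesis
      using T t by (intro vector_derivative_unique_within_closed_interval[of 0 T t "\<Phi> x"]) simp_all
  qed
  obtain B where B: "0 \<le> B"
    "\<And>p v. p + v \<in> ?K \<Longrightarrow> p - v \<in> ?K \<Longrightarrow>
        \<bar>D (p + v) (0, 1) + D (p - v) (0, 1) - 2 * D p (0, 1)\<bar> \<le> B * (norm v)\<^sup>2"
    by (rule second_difference_bound[OF D2, of ?K])
      (auto intro!: compact_Times convex_Times)
  show thesis
  proof
    fix x t s assume x: "x \<in> X" and t: "0 \<le> t" "0 \<le> s" "t + s \<le> T"
    show "\<bar>\<Phi> x (t + s) - \<Phi> x t - s / 2 * (R x t + R x (t + s))\<bar> \<le> B * s ^ 3"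
    proof (rule trapezoid_error)
      show "(\<Phi> x has_real_derivative R x \<tau>) (at \<tau> within {t..t + s})" if "\<tau> \<in> {t..t + s}" for \<tau>
        using that t by (intro DERIV_subset[OF deriv[OF x]]) auto
      fix \<tau> v assume v: "\<tau> + v \<in> {t..t + s}" "\<tau> - v \<in> {t..t + s}"
      then have "\<tau> + v \<in> {0..T}" "\<tau> - v \<in> {0..T}" "\<tau> \<in> {0..T}" using t by auto
      then show "\<bar>R x (\<tau> + v) + R x (\<tau> - v) - 2 * R x \<tau>\<bar> \<le> B * v\<^sup>2"
        using B(2)[of "(x, \<tau>)" "(0, v)"] subsetD[OF X x] by (simp add: R[OF x] norm_Pair del: atLeastAtMost_iff)
    qed (use t B in auto)
  qed fact
qed

text \<open>A discrete product rule. The argument of \<open>f\<close> moves against that of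
  \<open>J\<close>, so \<open>jp\<close> is paired with \<open>gm\<close>; expanding about the
  centre leaves two second differences and two products of first differences, four terms of size
  \<open>A * B\<close> times the squared norm of \<open>v\<close>.\<close>

lemma C2_bounded_convolution_integrand:
  assumes J: "C2_bounded A R J" and f: "C2_bounded B R f" and v: "v \<in> cbox 0 R"
  shows "\<bar>J (c + v) * f (x - (c + v)) + J (c - v) * f (x - (c - v)) - 2 * (J c * f (x - c))\<bar>
           \<le> 4 * A * B * (norm v)\<^sup>2"
proof -
  define j jp jm where "j = J c" and "jp = J (c + v)" and "jm = J (c - v)"
  define g gp gm where "g = f (x - c)" and "gp = f (x - c + v)" and "gm = f (x - c - v)"
  note D = C2_boundedD[OF J] C2_boundedD[OF f]
  have "J (c + v) * f (x - (c + v)) + J (c - v) * f (x - (c - v)) - 2 * (J c * f (x - c))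
      = jp * gm + jm * gp - 2 * (j * g)"
    by (simp add: j_def jp_def jm_def g_def gp_def gm_def algebra_simps)
  also have "\<dots> = g * (jp + jm - 2 * j) + j * (gp + gm - 2 * g) + (jp - j) * (gm - g) + (jm - j) * (gp - g)"
    by algebra
  also have "\<bar>\<dots>\<bar> \<le> \<bar>g * (jp + jm - 2 * j)\<bar> + \<bar>j * (gp + gm - 2 * g)\<bar> + \<bar>(jp - j) * (gm - g)\<bar>
      + \<bar>(jm - j) * (gp - g)\<bar>" by linarith
  also have "\<dots> \<le> B * (A * (norm v)\<^sup>2) + A * (B * (norm v)\<^sup>2) + A * norm v * (B * norm v)
      + A * norm v * (B * norm v)"
    unfolding abs_mult j_def jp_def jm_def g_def gp_def gm_def
    by (intro add_mono mult_mono D v) (auto simp: D)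
  also have "\<dots> = 4 * A * B * (norm v)\<^sup>2" by (simp add: power2_eq_square)
  finally show ?thesis .
qed

lemma periodic_convolution_integrand:
  assumes "periodic L1 L2 J" "periodic L1 L2 f"
  shows "periodic L1 L2 (\<lambda>y. J y * f (x - y))"
proof (cases x)
  case (Pair a b)
  have "f (a - (y1 + L1), b - y2) = f (a - y1, b - y2)" "f (a - y1, b - (y2 + L2)) = f (a - y1, b - y2)" for y1 y2
    using assms(2)[unfolded periodic_def, rule_format, of "a - (y1 + L1)" "b - y2"]
      assms(2)[unfolded periodic_def, rule_format, of "a - y1" "b - (y2 + L2)"] by simp_all
  then show ?thesis using assms(1) by (simp add: periodic_def Pair)
qed

text \<open>Vertex \<open>k + 1/2\<close> lies at \<open>k * h\<close>, and the cell centre with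
  index \<open>i - k\<close> lies at \<open>gp h i - k * h\<close>. The discrete convolution is
  therefore exactly the lattice quadrature of the convolution integrand at a cell centre.\<close>

lemma dconv_pconv_error:
  assumes J: "C2_bounded A (L1, L2) J" "periodic L1 L2 J"
    and f: "C2_bounded B (L1, L2) f" "periodic L1 L2 f"
    and L: "L1 = real m * h" "L2 = real n * h" and pos: "0 < h" "0 < m" "0 < n"
  shows "\<bar>dconv h m n (vert_restrict h J) (cell_restrict h f) i j - pconv L1 L2 J f (gp h i, gp h j)\<bar>
           \<le> 4 * A * B * (L1 * L2) * h\<^sup>2"
proof -
  define x where "x = (gp h i, gp h j)"
  define g where "g = (\<lambda>y. J y * f (x - y))"
  have hL: "h \<le> L1" "h \<le> L2"
    using pos by (auto simp: L)
  have "dconv h m n (vert_restrict h J) (cell_restrict h f) i j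
      = h\<^sup>2 * (\<Sum>k=1..int m. \<Sum>l=1..int n. g (of_int k * h, of_int l * h))"
    by (simp add: dconv_def vert_restrict_def cell_restrict_def gp_def g_def x_def algebra_simps)
  moreover have "pconv L1 L2 J f (gp h i, gp h j) = integral (Omega L1 L2) g"
    by (simp add: pconv_def g_def x_def)
  moreover have "\<bar>h\<^sup>2 * (\<Sum>k=1..int m. \<Sum>l=1..int n. g (of_int k * h, of_int l * h)) - integral (Omega L1 L2) g\<bar>
      \<le> 4 * A * B * (L1 * L2) * h\<^sup>2"
  proof (rule periodic_quadrature_error[OF _ _ L pos])
    show "continuous_on UNIV g" unfolding g_def
      by (intro continuous_intros continuous_on_compose2[OF C2_boundedD(1)[OF f(1)]]
          C2_boundedD(1)[OF J(1)]) auto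
    show "periodic L1 L2 g" unfolding g_def by (rule periodic_convolution_integrand[OF J(2) f(2)])
    show "0 \<le> 4 * A * B" using C2_boundedD(3)[OF J(1)] C2_boundedD(3)[OF f(1)] by simp
    fix c v assume "v \<in> cbox 0 (h, h)"
    then have "v \<in> cbox 0 (L1, L2)" using hL by (cases v) (auto simp: zero_prod_def)
    from C2_bounded_convolution_integrand[OF J(1) f(1) this]
    show "\<bar>g (c + v) + g (c - v) - 2 * g c\<bar> \<le> 4 * A * B * (norm v)\<^sup>2"
      by (simp add: g_def)
  qed
  ultimately show ?thesis by simp
qed

subsection \<open>Stability and consistency of one step\<close>

text \<open>The differential equation is posed on \<open>Omega\<close> only, so one-step estimates
  are first proved for indices in one period.\<close>

lemma grid_periodic_bound:
  assumes per: "grid_periodic m n g" and pos: "0 < m" "0 < n"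
    and bd: "\<And>i j. i \<in> {1..int m} \<Longrightarrow> j \<in> {1..int n} \<Longrightarrow> \<bar>g i j\<bar> \<le> B"
  shows "\<bar>g i j\<bar> \<le> B"
proof -
  \<comment> \<open>The index is lowered by one before \<open>mod\<close> because periods are
    numbered from 1.\<close>
  define i' j' where "i' = (i - 1) mod int m + 1" and "j' = (j - 1) mod int n + 1"
  have "i = i' + (i - 1) div int m * int m" "j = j' + (j - 1) div int n * int n"
    using div_mult_mod_eq[of "i - 1" "int m"] div_mult_mod_eq[of "j - 1" "int n"]
    by (auto simp: i'_def j'_def)
  then have "g i j = g i' j'" using per unfolding grid_periodic_def by metis
  moreover have "i' \<in> {1..int m}" "j' \<in> {1..int n}"
    using pos pos_mod_bound[of "int m" "i - 1"] pos_mod_bound[of "int n" "j - 1"] by (auto simp: i'_def j'_def add1_zle_eq)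
  ultimately show ?thesis using bd by simp
qed

lemma grid_norm2_le:
  assumes "\<And>i j. \<bar>g i j\<bar> \<le> B" "0 \<le> h"
  shows "grid_norm2 h m n g \<le> sqrt (real m * h * (real n * h)) * B"
proof -
  have B: "0 \<le> B" using assms(1) order_trans[OF abs_ge_zero] by blast
  have "(\<Sum>i=1..int m. \<Sum>j=1..int n. (g i j)\<^sup>2) \<le> (\<Sum>i=1..int m. \<Sum>j=1..int n. B\<^sup>2)"
    using assms(1) by (intro sum_mono) (metis abs_ge_zero power2_abs power_mono)
  then have "h\<^sup>2 * (\<Sum>i=1..int m. \<Sum>j=1..int n. (g i j)\<^sup>2) \<le> h\<^sup>2 * (real m * (real n * B\<^sup>2))"
    by (intro mult_left_mono) auto
  also have "\<dots> = real m * h * (real n * h) * B\<^sup>2" by (simp add: power2_eq_square)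
  finally have "grid_norm2 h m n g \<le> sqrt (real m * h * (real n * h) * B\<^sup>2)"
    unfolding grid_norm2_def by simp
  then show ?thesis using B by (simp add: real_sqrt_mult)
qed

text \<open>The weight \<open>h^2\<close> times the number of nodes is the area of the domain, so
  the bound does not degenerate under grid refinement.\<close>

lemma dconv_abs_le:
  assumes "\<And>k l. \<bar>f k l\<bar> \<le> A" "\<And>i j. \<bar>g i j\<bar> \<le> B"
  shows "\<bar>dconv h m n f g i j\<bar> \<le> A * (real m * h * (real n * h)) * B"
proof -
  have "\<bar>\<Sum>k=1..int m. \<Sum>l=1..int n. f k l * g (i - k) (j - l)\<bar> \<le> (\<Sum>k=1..int m. \<Sum>l=1..int n. A * B)"
  proof (rule order_trans[OF sum_abs], intro sum_mono, rule order_trans[OF sum_abs], intro sum_mono)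
    fix k l
    show "\<bar>f k l * g (i - k) (j - l)\<bar> \<le> A * B"
      unfolding abs_mult by (intro mult_mono assms) (use assms(1)[of k l] in auto)
  qed
  then have "h\<^sup>2 * \<bar>\<Sum>k=1..int m. \<Sum>l=1..int n. f k l * g (i - k) (j - l)\<bar>
      \<le> h\<^sup>2 * (real m * (real n * (A * B)))"
    by (intro mult_left_mono) auto
  then show ?thesis by (simp add: dconv_def abs_mult power2_eq_square mult_ac)
qed

lemma dconv_diff:
  "dconv h m n f (\<lambda>i j. g1 i j - g2 i j) i j = dconv h m n f g1 i j - dconv h m n f g2 i j"
  by (simp add: dconv_def right_diff_distrib sum_subtractf)

lemma dconv_average:
  "dconv h m n f (\<lambda>i j. 1/2 * (g1 i j + g2 i j)) i j = (dconv h m n f g1 i j + dconv h m n f g2 i j) / 2"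
proof -
  have "f k l * (1/2 * (g1 a b + g2 a b)) = (f k l * g1 a b + f k l * g2 a b) * (1/2)" for k l a b
    by (simp add: algebra_simps)
  then show ?thesis
    unfolding dconv_def by (simp add: sum.distrib flip: sum_distrib_right sum_divide_distrib) (simp add: algebra_simps)
qed

text \<open>No bound on the new value \<open>b\<close> is needed, because \<open>\<eta>\<close> is monotone in its second argument.\<close>

lemma scheme_step_stability:
  fixes u v a b :: real
  assumes bd: "\<bar>u\<bar> \<le> B" "\<bar>v\<bar> \<le> B" "\<bar>a\<bar> \<le> B" and nn: "0 \<le> \<sigma>" "0 \<le> p"
    and exact: "\<bar>v - u + \<sigma> * (eta u v + p * (1/2 * (u + v)) - x)\<bar> \<le> \<rho>"
    and num: "b - a = - \<sigma> * (eta a b + p * (1/2 * (a + b)) - y)"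
    and xy: "\<bar>x - y\<bar> \<le> \<xi>"
  shows "\<bar>v - b\<bar> \<le> (1 + \<sigma> * (3/2 * B\<^sup>2 + p/2)) * \<bar>u - a\<bar> + \<sigma> * \<xi> + \<rho>"
proof -
  \<comment> \<open>\<open>c\<close> and \<open>d\<close> are the difference quotients of
    \<open>eta\<close> in its second and first argument. Since \<open>4 * c\<close> is a sum of
    squares, \<open>c\<close> is nonnegative; \<open>d\<close> is a quarter of six products, each
    bounded by \<open>B^2\<close>.\<close>
  define c where "c = 1/4 * (a\<^sup>2 + a * (v + b) + v\<^sup>2 + v * b + b\<^sup>2)"
  define d where "d = 1/4 * (u\<^sup>2 + u * a + a\<^sup>2 + (u + a) * v + v\<^sup>2)"
  define r where "r = v - u + \<sigma> * (eta u v + p * (1/2 * (u + v)) - x)"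
  have "0 \<le> (a + (v + b) / 2)\<^sup>2 + (v + b)\<^sup>2 / 4 + v\<^sup>2 / 2 + b\<^sup>2 / 2" by simp
  also have "\<dots> = 4 * c" by (simp add: c_def power2_eq_square field_simps)
  finally have c: "0 \<le> c" by simp
  have sq: "\<bar>s * t\<bar> \<le> B\<^sup>2" if "\<bar>s\<bar> \<le> B" "\<bar>t\<bar> \<le> B" for s t
    unfolding abs_mult power2_eq_square using that by (intro mult_mono) auto
  note sqs = sq[OF bd(1,1)] sq[OF bd(1,3)] sq[OF bd(3,3)] sq[OF bd(1,2)] sq[OF bd(3,2)] sq[OF bd(2,2)]
  have "d \<le> 3/2 * B\<^sup>2" "- d \<le> 3/2 * B\<^sup>2"
    using sqs[THEN abs_le_D1] sqs[THEN abs_le_D2]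
    unfolding d_def power2_eq_square[of u] power2_eq_square[of a] power2_eq_square[of v] 
    by (auto simp: field_simps)
  then have "\<bar>d\<bar> \<le> 3/2 * B\<^sup>2" by (rule abs_leI)
  have tri: "\<bar>t1 - t2 + t3 + t4\<bar> \<le> \<bar>t1\<bar> + \<bar>t2\<bar> + \<bar>t3\<bar> + \<bar>t4\<bar>" for t1 t2 t3 t4 :: real
    by linarith
  \<comment> \<open>Error equation with all terms in the new error \<open>v - b\<close> collected on
    the left. Their factor is at least 1 and is dropped at the end.\<close>
  have "(v - b) * (1 + \<sigma> * (c + p/2)) = (u - a) - \<sigma> * (d + p/2) * (u - a) + \<sigma> * (x - y) + r"
  proof -
    have "eta u v = eta a v + d * (u - a)" "eta a v = eta a b + c * (v - b)"
      by (simp_all add: eta_def c_def d_def power2_eq_square field_simps)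
    then have e: "eta u v = eta a b + c * (v - b) + d * (u - a)" by simp
    show ?thesis using num unfolding r_def e by (simp add: field_simps)
  qed
  also have "\<bar>\<dots>\<bar> \<le> \<bar>u - a\<bar> + \<bar>\<sigma> * (d + p/2) * (u - a)\<bar> + \<bar>\<sigma> * (x - y)\<bar> + \<bar>r\<bar>"
    by (rule tri)
  also have "\<dots> \<le> \<bar>u - a\<bar> + \<sigma> * (3/2 * B\<^sup>2 + p/2) * \<bar>u - a\<bar> + \<sigma> * \<xi> + \<rho>"
  proof -
    have "\<bar>\<sigma> * (d + p/2) * (u - a)\<bar> \<le> \<sigma> * (3/2 * B\<^sup>2 + p/2) * \<bar>u - a\<bar>"
      unfolding abs_mult using nn \<open>\<bar>d\<bar> \<le> 3/2 * B\<^sup>2\<close> by (intro mult_right_mono mult_mono) auto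
    moreover have "\<bar>\<sigma> * (x - y)\<bar> \<le> \<sigma> * \<xi>"
      unfolding abs_mult using nn xy by (intro mult_mono) auto
    ultimately show ?thesis using exact by (simp add: r_def)
  qed
  finally have "\<bar>v - b\<bar> * \<bar>1 + \<sigma> * (c + p/2)\<bar>
      \<le> \<bar>u - a\<bar> + \<sigma> * (3/2 * B\<^sup>2 + p/2) * \<bar>u - a\<bar> + \<sigma> * \<xi> + \<rho>"
    unfolding abs_mult .
  moreover have "\<bar>v - b\<bar> * 1 \<le> \<bar>v - b\<bar> * \<bar>1 + \<sigma> * (c + p/2)\<bar>"
    using nn c by (intro mult_left_mono) auto
  ultimately show ?thesis by (simp add: algebra_simps)
qed

text \<open>Here \<open>u\<close> and \<open>v\<close> are exact values at consecutive times,
  \<open>w\<close> is the extrapolated value and \<open>q\<close> its discrete convolution. Beyond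
  the trapezoidal error, \<open>E\<close> collects the defect of \<open>eta\<close> against the mean
  of the cubes, namely \<open>- 1/4 * (u + v) * (v - u)^2\<close>, and the errors of the quadratures
  and of the extrapolation.\<close>

lemma scheme_step_consistency:
  fixes u v :: real
  assumes trap: "\<bar>v - u - s / 2 * (ru + rv)\<bar> \<le> Bt * s ^ 3"
    and ru: "ru = - M * (u ^ 3 + \<gamma>c * u - \<gamma>e * u + (Ic - Ie) * u - bu)"
    and rv: "rv = - M * (v ^ 3 + \<gamma>c * v - \<gamma>e * v + (Ic - Ie) * v - bv)"
    and bd: "\<bar>u\<bar> \<le> B" "\<bar>v\<bar> \<le> B" "\<bar>v - u\<bar> \<le> B * s"
    and nn: "0 \<le> M" "0 \<le> s"
    and Ac: "\<bar>Ac - Ic\<bar> \<le> \<kappa>" and Ae: "\<bar>Ae - Ie\<bar> \<le> \<kappa>" and Q: "\<bar>Ae + \<gamma>e\<bar> \<le> Q"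
    and w: "\<bar>w - 1/2 * (u + v)\<bar> \<le> \<delta>"
    and q: "\<bar>q - (bu + bv) / 2\<bar> \<le> \<kappa>' + A * \<delta>"
  shows "\<bar>v - u + M * s * (eta u v + (Ac + \<gamma>c) * (1/2 * (u + v)) - ((Ae + \<gamma>e) * w + q))\<bar>
    \<le> Bt * s ^ 3 + M * s * (1/2 * B ^ 3 * s\<^sup>2 + 2 * \<kappa> * B + \<kappa>' + (Q + A) * \<delta>)"
proof -
  define H where "H = 1/2 * (u + v)"
  define E where "E = - 1/4 * ((u + v) * (v - u)\<^sup>2) + (Ac - Ic) * H - (Ae - Ie) * H
      - (Ae + \<gamma>e) * (w - H) - (q - (bu + bv) / 2)"
  have B: "0 \<le> B" using bd(1) by linarith
  have "v - u + M * s * (eta u v + (Ac + \<gamma>c) * (1/2 * (u + v)) - ((Ae + \<gamma>e) * w + q))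
      = (v - u - s / 2 * (ru + rv)) + M * s * E"
    unfolding ru rv E_def H_def eta_def
    by (simp add: field_simps power2_eq_square power3_eq_cube)
  also have "\<bar>\<dots>\<bar> \<le> \<bar>v - u - s / 2 * (ru + rv)\<bar> + M * s * \<bar>E\<bar>"
    using nn abs_triangle_ineq[of "v - u - s / 2 * (ru + rv)" "M * s * E"] by (simp add: abs_mult)
  also have "\<dots> \<le> Bt * s ^ 3 + M * s * (1/2 * B ^ 3 * s\<^sup>2 + 2 * \<kappa> * B + \<kappa>' + (Q + A) * \<delta>)"
  proof (intro add_mono trap mult_left_mono)
    have H: "\<bar>H\<bar> \<le> B" using bd by (auto simp: H_def abs_le_iff)
    have "\<bar>(u + v) * (v - u)\<^sup>2\<bar> \<le> (2 * B) * (B * s)\<^sup>2"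
      unfolding abs_mult
    proof (intro mult_mono)
      show "\<bar>(v - u)\<^sup>2\<bar> \<le> (B * s)\<^sup>2" using bd(3) power_mono[of "\<bar>v - u\<bar>" "B * s" 2] by simp
    qed (use bd in auto)
    then have 1: "\<bar>- 1/4 * ((u + v) * (v - u)\<^sup>2)\<bar> \<le> 1/2 * B ^ 3 * s\<^sup>2"
      by (simp add: abs_mult power_mult_distrib power2_eq_square power3_eq_cube mult_ac)
    have 2: "\<bar>(Ac - Ic) * H\<bar> \<le> \<kappa> * B" "\<bar>(Ae - Ie) * H\<bar> \<le> \<kappa> * B"
      unfolding abs_mult using Ac Ae H by (intro mult_mono; linarith)+
    have 3: "\<bar>(Ae + \<gamma>e) * (w - H)\<bar> \<le> Q * \<delta>"
      unfolding abs_mult using Q w by (intro mult_mono; simp add: H_def; linarith)+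
    have "\<bar>E\<bar> \<le> \<bar>- 1/4 * ((u + v) * (v - u)\<^sup>2)\<bar> + \<bar>(Ac - Ic) * H\<bar> + \<bar>(Ae - Ie) * H\<bar>
        + \<bar>(Ae + \<gamma>e) * (w - H)\<bar> + \<bar>q - (bu + bv) / 2\<bar>"
      unfolding E_def by linarith
    also have "\<dots> \<le> 1/2 * B ^ 3 * s\<^sup>2 + \<kappa> * B + \<kappa> * B + Q * \<delta> + (\<kappa>' + A * \<delta>)"
      by (intro add_mono 1 2 3 q)
    finally show "\<bar>E\<bar> \<le> 1/2 * B ^ 3 * s\<^sup>2 + 2 * \<kappa> * B + \<kappa>' + (Q + A) * \<delta>"
      by (simp add: algebra_simps)
  qed (use nn in auto)
  finally show ?thesis .
qed

text \<open>The per-step estimate is only available while the error is at most one; smallness of the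
  final bound keeps the induction inside that regime.\<close>

lemma error_recursion_bound:
  fixes e :: "nat \<Rightarrow> 'i \<Rightarrow> real"
  assumes e0: "\<And>i. e 0 i = 0" and nn: "0 \<le> c" "0 \<le> A1" "0 \<le> A2"
    and step: "\<And>k \<delta> i. k < N \<Longrightarrow> \<delta> \<le> 1 \<Longrightarrow> (\<And>i. \<bar>e k i\<bar> \<le> \<delta>) \<Longrightarrow> (\<And>i. \<bar>e (k - 1) i\<bar> \<le> \<delta>) \<Longrightarrow>
        \<bar>e (Suc k) i\<bar> \<le> (1 + c) * \<delta> + (if k = 0 then A1 else A2)"
    and small: "(1 + c) ^ N * (A1 + real N * A2) \<le> 1"
  shows "\<bar>e N i\<bar> \<le> (1 + c) ^ N * (A1 + real N * A2)"
proof -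
  define b where "b = (\<lambda>k. (1 + c) ^ k * (A1 + real k * A2))"
  have mono: "b k \<le> b l" if "k \<le> l" for k l
    unfolding b_def using that nn
    by (intro mult_mono power_increasing add_mono mult_right_mono) auto
  have "\<bar>e k i\<bar> \<le> b k" if "k \<le> N" for k i
    using that
  proof (induction k arbitrary: i rule: less_induct)
    case (less k)
    show ?case
    proof (cases k)
      case 0
      then show ?thesis using nn by (simp add: e0 b_def)
    next
      case (Suc l)
      show ?thesis
      proof (cases "l = 0")
        \<comment> \<open>The error before the first step is zero, so \<open>\<delta> = 0\<close> is
          admissible and only \<open>A1\<close> remains.\<close>
        case True
        have "\<bar>e (Suc 0) i\<bar> \<le> (1 + c) * 0 + (if (0::nat) = 0 then A1 else A2)"
          using less.prems Suc True by (intro step) (auto simp: e0)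
        then have "\<bar>e k i\<bar> \<le> 1 * (A1 + 0)" by (simp add: Suc True)
        also have "\<dots> \<le> b k"
          unfolding b_def Suc True using nn by (intro mult_mono add_mono) auto
        finally show ?thesis .
      next
        case False
        have "\<bar>e (Suc l) i\<bar> \<le> (1 + c) * b l + (if l = 0 then A1 else A2)"
        proof (rule step)
          show "l < N" using less.prems Suc by simp
          show "b l \<le> 1" using mono[of l N] small less.prems Suc by (simp add: b_def)
          show "\<bar>e l i\<bar> \<le> b l" for i using less Suc by simp
          show "\<bar>e (l - 1) i\<bar> \<le> b l" for i
            by (rule order_trans[OF less.IH mono]) (use less.prems Suc in auto)
        qed
        also have "\<dots> \<le> (1 + c) * b l + (1 + c) ^ k * A2"
          using False nn one_le_power[of "1 + c" k] mult_right_mono[of 1 "(1 + c) ^ k" A2] by simp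
        also have "\<dots> = b k" by (simp add: b_def Suc algebra_simps)
        finally show ?thesis using Suc by simp
      qed
    qed
  qed
  then show ?thesis by (simp add: b_def)
qed

subsection \<open>Convergence\<close>

text \<open>Groups the extrapolated terms into one quantity, the \<open>y\<close> of
  \<open>scheme_step_stability\<close>, and merges the two kernels into the restriction of their
  difference.\<close>

lemma nAC_scheme_step:
  fixes \<phi> :: "nat \<Rightarrow> grid" and k :: nat
  assumes "nAC_scheme h m n s M \<gamma>c \<gamma>e (vert_restrict h Jc) (vert_restrict h Je) \<phi>"
  defines "hat \<equiv> \<lambda>i j. 3/2 * \<phi> k i j - 1/2 * \<phi> (k - 1) i j"
  shows "\<phi> (Suc k) i j - \<phi> k i j = - (M * s) *
    (eta (\<phi> k i j) (\<phi> (Suc k) i j)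
      + (dconv h m n (vert_restrict h Jc) (\<lambda>_ _. 1) i j + \<gamma>c) * (1/2 * (\<phi> k i j + \<phi> (Suc k) i j))
      - ((dconv h m n (vert_restrict h Je) (\<lambda>_ _. 1) i j + \<gamma>e) * hat i j
         + dconv h m n (vert_restrict h (\<lambda>x. Jc x - Je x)) hat i j))"
proof -
  have "(\<lambda>k l. vert_restrict h Jc k l - vert_restrict h Je k l) = vert_restrict h (\<lambda>x. Jc x - Je x)"
    by (simp add: vert_restrict_def)
  then show ?thesis
    using assms(1) unfolding nAC_scheme_def nAC_potential_def hat_def Let_def
    by (simp add: algebra_simps)
qed

lemma gp_pair_in_Omega:
  assumes "0 < h" "i \<in> {1..int m}" "j \<in> {1..int n}"
  shows "(gp h i, gp h j) \<in> Omega (real m * h) (real n * h)"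
proof -
  have "0 < gp h k \<and> gp h k < real q * h" if "k \<in> {1..int q}" for k q
  proof -
    have "0 < (of_int k - 1/2) * h" "(of_int k - 1/2) * h < real q * h"
      using that assms(1) by (auto intro!: mult_pos_pos mult_strict_right_mono)
    then show ?thesis by (simp add: gp_def)
  qed
  from this[OF assms(2)] this[OF assms(3)] show ?thesis by (simp add: Omega_def)
qed

lemma grid_periodic_cell_restrict:
  assumes "periodic (real m * h) (real n * h) f"
  shows "grid_periodic m n (cell_restrict h f)"
proof -
  have "gp h (real_of_int (i + a * int q)) = gp h (real_of_int i) + real_of_int a * (real q * h)" for i a q
    by (simp add: gp_def algebra_simps)
  then show ?thesis
    using periodic_shift[OF assms] by (simp add: grid_periodic_def cell_restrict_def)
qed

theorem theorem3p9:
  fixes L1 L2 M \<gamma>c \<gamma>e T :: real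
    and Jc Je \<Phi>0 :: "real \<times> real \<Rightarrow> real"
    and \<Phi> :: "real \<times> real \<Rightarrow> real \<Rightarrow> real"
  defines "J \<equiv> (\<lambda>x. Jc x - Je x)"
  assumes L_pos: "0 < L1" "0 < L2"
    and M_nonneg: "0 \<le> M"
    and A1_smooth: "Cinf_per L1 L2 Jc" "Cinf_per L1 L2 Je"
    and A1_nonneg: "\<And>x. 0 \<le> Jc x" "\<And>x. 0 \<le> Je x"
    and A2: "\<And>x. Jc (- x) = Jc x" "\<And>x. Je (- x) = Je x"
    and A3: "0 < integral (Omega L1 L2) J"
    and gamma_nonneg: "0 \<le> \<gamma>c" "0 \<le> \<gamma>e"
    and gamma0_pos: "0 < \<gamma>c - \<gamma>e + integral (Omega L1 L2) J"
    and T_pos: "0 < T"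
    and init: "Cinf_per L1 L2 \<Phi>0"
    and sol: "nAC_solution L1 L2 M \<gamma>c \<gamma>e J T \<Phi>0 \<Phi>"
    and sol_unique: "\<And>\<Psi>. nAC_solution L1 L2 M \<gamma>c \<gamma>e J T \<Phi>0 \<Psi> \<Longrightarrow>
                        (\<forall>x. \<forall>t\<in>{0..T}. \<Psi> x t = \<Phi> x t)"
  shows "\<exists>s0>0. \<exists>h0>0. \<exists>C>0.
           \<forall>(s::real) (h::real) (m::nat) (n::nat) (\<phi> :: nat \<Rightarrow> grid).
             0 < s \<and> s \<le> s0 \<and> 0 < h \<and> h \<le> h0 \<and> 0 < m \<and> 0 < n \<and>
             L1 = real m * h \<and> L2 = real n * h \<and>
             nAC_scheme h m n s M \<gamma>c \<gamma>e (vert_restrict h Jc) (vert_restrict h Je) \<phi> \<and>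
             \<phi> 0 = cell_restrict h (\<lambda>x. \<Phi> x 0)
             \<longrightarrow> (\<forall>l::nat. 0 < l \<and> real l * s \<le> T \<longrightarrow>
                    grid_norm2 h m n (\<lambda>i j. cell_restrict h (\<lambda>x. \<Phi> x (real l * s)) i j - \<phi> l i j)
                      \<le> C * (h^2 + s^2))"
proof -

  \<comment> \<open>Uniform bounds for the kernels and the exact solution\<close>
  obtain A where Jc: "C2_bounded A (L1, L2) Jc" and Je: "C2_bounded A (L1, L2) Je"
    using Cinf_per_C2_bounded[OF L_pos A1_smooth(1)] Cinf_per_C2_bounded[OF L_pos A1_smooth(2)]
    by (metis C2_bounded_mono max.cobounded1 max.cobounded2)
  have A: "0 \<le> A" by (rule C2_boundedD(3)[OF Jc])
  have perJ: "periodic L1 L2 Jc" "periodic L1 L2 Je" "periodic L1 L2 J"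
    using A1_smooth by (auto simp: Cinf_per_def periodic_def J_def)
  have J: "C2_bounded (2 * A) (L1, L2) J"
    using C2_bounded_diff[OF Jc Je] by (simp add: J_def)
  define Ic Ie where "Ic = integral (Omega L1 L2) Jc" and "Ie = integral (Omega L1 L2) Je"
  have IJ: "integral (Omega L1 L2) J = Ic - Ie"
    unfolding Ic_def Ie_def J_def integral_Omega
    by (intro integral_diff integrable_continuous continuous_on_subset[OF C2_boundedD(1)[OF Jc]]
        continuous_on_subset[OF C2_boundedD(1)[OF Je]]) auto
  have smooth: "Ck_on k (\<lambda>(x, t). \<Phi> x t) (UNIV \<times> {0..T})" for k
    using sol by (simp add: nAC_solution_def smooth_on_def)
  have per\<Phi>: "periodic L1 L2 (\<lambda>x. \<Phi> x t)" if "t \<in> {0..T}" for t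
    using sol that by (simp add: nAC_solution_def)
  obtain B where \<Phi>: "\<And>t. t \<in> {0..T} \<Longrightarrow> C2_bounded B (L1, L2) (\<lambda>x. \<Phi> x t)"
    and \<Phi>_lip: "\<And>x t t'. t \<in> {0..T} \<Longrightarrow> t' \<in> {0..T} \<Longrightarrow> \<bar>\<Phi> x t - \<Phi> x t'\<bar> \<le> B * \<bar>t - t'\<bar>"
    and \<Phi>_second: "\<And>x t \<sigma>. t + \<sigma> \<in> {0..T} \<Longrightarrow> t - \<sigma> \<in> {0..T} \<Longrightarrow>
        \<bar>\<Phi> x (t + \<sigma>) + \<Phi> x (t - \<sigma>) - 2 * \<Phi> x t\<bar> \<le> B * \<sigma>\<^sup>2"
    using smooth_evolution_bounds[OF L_pos smooth per\<Phi>] by blast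
  have B: "0 \<le> B" using C2_boundedD(3)[OF \<Phi>[of 0]] T_pos by simp
  define conv where "conv = (\<lambda>x t. pconv L1 L2 J (\<lambda>y. \<Phi> y t) x)"
  define R where "R = (\<lambda>x t. - M * ((\<Phi> x t)^3 + \<gamma>c * \<Phi> x t - \<gamma>e * \<Phi> x t + (Ic - Ie) * \<Phi> x t - conv x t))"
  have pde: "((\<lambda>\<tau>. \<Phi> x \<tau>) has_real_derivative R x t) (at t within {0..T})"
    if "x \<in> Omega L1 L2" "t \<in> {0..T}" for x t
    using sol that unfolding nAC_solution_def R_def conv_def pconv_one IJ by blast
  have Omega_sub: "Omega L1 L2 \<subseteq> cbox 0 (L1, L2)"
    by (simp add: Omega_eq_box box_subset_cbox)
  obtain Bt where Bt: "0 \<le> Bt"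
    and trap: "\<And>x t s. x \<in> Omega L1 L2 \<Longrightarrow> 0 \<le> t \<Longrightarrow> 0 \<le> s \<Longrightarrow> t + s \<le> T \<Longrightarrow>
        \<bar>\<Phi> x (t + s) - \<Phi> x t - s / 2 * (R x t + R x (t + s))\<bar> \<le> Bt * s ^ 3"
    using smooth_evolution_trapezoid[OF smooth T_pos Omega_sub pde] by blast

  \<comment> \<open>Constants independent of the grid and the time step\<close>
  define area where "area = L1 * L2"
  have area: "0 < area" using L_pos by (simp add: area_def)
  \<comment> \<open>\<open>Q\<close> bounds the coefficient of the extrapolated value;
    \<open>\<kappa>\<close> and \<open>\<kappa>'\<close> are the quadrature constants for convolving
    \<open>Jc\<close> or \<open>Je\<close> with 1 and \<open>J\<close> with the solution.\<close>
  define Q \<kappa> \<kappa>' where "Q = A * area + \<gamma>e" and "\<kappa> = 4 * A * area" and "\<kappa>' = 8 * A * B * area"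
  have pos: "0 \<le> Q" "0 \<le> \<kappa>" "0 \<le> \<kappa>'" "0 \<le> Q + 2 * A * area"
    using A B area gamma_nonneg by (auto simp: Q_def \<kappa>_def \<kappa>'_def)
  define C1 where "C1 = Bt + M * (1/2 * B ^ 3 + 2 * \<kappa> * B + \<kappa>' + (Q + 2 * A * area) * B)"
  \<comment> \<open>Growth rate from the stability estimate with solution bound
    \<open>B + 1\<close>; the last factor 2 is the sum 3/2 + 1/2 of the absolute extrapolation
    weights.\<close>
  define cc where "cc = M * (3/2 * (B + 1)\<^sup>2 + (A * area + \<gamma>c) / 2 + 2 * (Q + 2 * A * area))"
  have C1: "0 \<le> C1" unfolding C1_def
    by (intro add_nonneg_nonneg mult_nonneg_nonneg Bt M_nonneg pos B zero_le_power) auto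
  have cc: "0 \<le> cc" unfolding cc_def
    by (intro add_nonneg_nonneg mult_nonneg_nonneg divide_nonneg_nonneg M_nonneg pos A gamma_nonneg less_imp_le[OF area]) auto
  \<comment> \<open>The exponential bounds the growth; in \<open>1 + T\<close>, the 1 pays for the
    first step and \<open>T\<close> for the accumulated regular steps.\<close>
  define E where "E = exp (cc * T) * (C1 * (1 + T))"
  have E: "0 \<le> E" using C1 T_pos by (simp add: E_def)
  \<comment> \<open>Serves as both \<open>s0\<close> and \<open>h0\<close>; it makes the final bound
    at most 1, as the induction requires.\<close>
  define d0 where "d0 = 1 / (1 + 2 * E)"
  have d0: "0 < d0" "d0 \<le> 1" "E * (d0\<^sup>2 + d0\<^sup>2) \<le> 1"
  proof -
    show "0 < d0" "d0 \<le> 1" using E by (auto simp: d0_def)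
    then have "d0\<^sup>2 \<le> d0" by (simp add: power2_eq_square mult_left_le)
    then have "E * (d0\<^sup>2 + d0\<^sup>2) \<le> E * (2 * d0)" using E by (intro mult_left_mono) auto
    also have "\<dots> \<le> 1" using E by (simp add: d0_def field_simps)
    finally show "E * (d0\<^sup>2 + d0\<^sup>2) \<le> 1" .
  qed
  have main: "grid_norm2 h m n (\<lambda>i j. cell_restrict h (\<lambda>x. \<Phi> x (real l * s)) i j - \<phi> l i j)
      \<le> (sqrt area * E + 1) * (h\<^sup>2 + s\<^sup>2)"
    if s: "0 < s" "s \<le> d0" and h: "0 < h" "h \<le> d0" and mn: "0 < m" "0 < n"
      and L: "L1 = real m * h" "L2 = real n * h"
      and scheme: "nAC_scheme h m n s M \<gamma>c \<gamma>e (vert_restrict h Jc) (vert_restrict h Je) \<phi>"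
      and \<phi>0: "\<phi> 0 = cell_restrict h (\<lambda>x. \<Phi> x 0)"
      and l: "0 < l" "real l * s \<le> T"
    for s h m n \<phi> l
  proof -

    \<comment> \<open>Discrete coefficients and nodal values on a fixed grid\<close>
    have area_eq: "real m * h * (real n * h) = area" by (simp add: area_def L)
    have s1: "s \<le> 1" using s d0 by linarith
    define U where "U = (\<lambda>k. cell_restrict h (\<lambda>x. \<Phi> x (real k * s)))"
    define e where "e = (\<lambda>k i j. U k i j - \<phi> k i j)"
    define Ac Ae where "Ac = dconv h m n (vert_restrict h Jc) (\<lambda>_ _. 1)"
      and "Ae = dconv h m n (vert_restrict h Je) (\<lambda>_ _. 1)"
    define JJ where "JJ = vert_restrict h J"
    have one: "C2_bounded 1 (L1, L2) (\<lambda>_. 1)" "periodic L1 L2 (\<lambda>_. 1)"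
      by (auto simp: C2_bounded_const periodic_def)
    have coeff_err: "\<bar>Ac i j - Ic\<bar> \<le> \<kappa> * h\<^sup>2" "\<bar>Ae i j - Ie\<bar> \<le> \<kappa> * h\<^sup>2" for i j
      using dconv_pconv_error[OF Jc perJ(1) one L h(1) mn, of i j]
        dconv_pconv_error[OF Je perJ(2) one L h(1) mn, of i j]
      by (auto simp: Ac_def Ae_def Ic_def Ie_def pconv_one \<kappa>_def area_def cell_restrict_def)
    have J_bd: "\<bar>vert_restrict h Jc k l\<bar> \<le> A" "\<bar>vert_restrict h Je k l\<bar> \<le> A" "\<bar>JJ k l\<bar> \<le> 2 * A" for k l
      using C2_boundedD(2)[OF Jc] C2_boundedD(2)[OF Je] C2_boundedD(2)[OF J]
      by (simp_all only: vert_restrict_def JJ_def)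
    have coeff_bd: "0 \<le> Ac i j" "Ac i j \<le> A * area" "0 \<le> Ae i j" "Ae i j \<le> A * area" for i j
    proof -
      show "0 \<le> Ac i j" "0 \<le> Ae i j"
        using A1_nonneg by (auto simp: Ac_def Ae_def dconv_def vert_restrict_def intro!: mult_nonneg_nonneg sum_nonneg)
      show "Ac i j \<le> A * area" "Ae i j \<le> A * area"
        using dconv_abs_le[where f = "vert_restrict h Jc", OF J_bd(1), where g = "\<lambda>_ _. 1" and B = 1 and h = h and m = m and n = n and i = i and j = j] dconv_abs_le[where f = "vert_restrict h Je", OF J_bd(2), where g = "\<lambda>_ _. 1" and B = 1 and h = h and m = m and n = n and i = i and j = j]
        by (auto simp: Ac_def Ae_def area_eq)
    qed
    have Q: "\<bar>Ae i j + \<gamma>e\<bar> \<le> Q" for i j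
      using coeff_bd[of i j] gamma_nonneg by (simp add: Q_def)
    have time: "real k * s \<in> {0..T}" if "k \<le> l" for k
    proof -
      have "real k * s \<le> real l * s" using that s by (intro mult_right_mono) auto
      then have "real k * s \<le> T" using l by linarith
      then show ?thesis using s by simp
    qed
    have U_bd: "\<bar>U k i j\<bar> \<le> B" if "k \<le> l" for k i j
      using C2_boundedD(2)[OF \<Phi>[OF time[OF that]]] by (simp add: U_def cell_restrict_def)
    have per_e: "grid_periodic m n (e k)" if "k \<le> l" for k
    proof -
      have "grid_periodic m n (U k)"
        unfolding U_def using per\<Phi>[OF time[OF that]] by (intro grid_periodic_cell_restrict) (simp add: L)
      moreover have "grid_periodic m n (\<phi> k)" using scheme by (simp add: nAC_scheme_def)
      ultimately show ?thesis by (simp add: grid_periodic_def e_def)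
    qed
    \<comment> \<open>Local errors of the first and of a later step.\<close>
    define A1 A2 where "A1 = C1 * (s * (s + h\<^sup>2))" and "A2 = C1 * (s * (s\<^sup>2 + h\<^sup>2))"

    \<comment> \<open>Error estimate for one step\<close>
    have step: "\<bar>e (Suc k) i j\<bar> \<le> (1 + cc * s) * \<delta> + (if k = 0 then A1 else A2)"
      if k: "k < l" and \<delta>1: "\<delta> \<le> 1" and ek: "\<And>i j. \<bar>e k i j\<bar> \<le> \<delta>" and ek': "\<And>i j. \<bar>e (k - 1) i j\<bar> \<le> \<delta>"
      for k \<delta> i j
    proof (rule grid_periodic_bound[OF per_e mn])
      show "Suc k \<le> l" using k by simp
      fix i j assume ij: "i \<in> {1..int m}" "j \<in> {1..int n}"
      define t where "t = real k * s"
      have t': "real (Suc k) * s = t + s" by (simp add: t_def algebra_simps)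
      have t: "t \<in> {0..T}" "t + s \<in> {0..T}"
        using time[of k] time[of "Suc k"] k by (simp_all only: t_def[symmetric] t')
      have \<delta>: "0 \<le> \<delta>" by (rule order_trans[OF abs_ge_zero ek])
      define w where "w = (\<lambda>i j. 3/2 * U k i j - 1/2 * U (k - 1) i j)"
      define w' where "w' = (\<lambda>i j. 3/2 * \<phi> k i j - 1/2 * \<phi> (k - 1) i j)"
      define half where "half = (\<lambda>i j. 1/2 * (U k i j + U (Suc k) i j))"
      \<comment> \<open>Bound for extrapolation minus midpoint average. At \<open>k = 0\<close> the
        truncated \<open>k - 1\<close> makes the extrapolation equal to the initial value, hence
        first order; later it is minus half a second difference in time.\<close>
      define \<theta> where "\<theta> = (if k = 0 then B * s else B * s\<^sup>2)"
      have w: "\<bar>w i j - half i j\<bar> \<le> \<theta>" for i j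
      proof -
        define x where "x = (gp h i, gp h j)"
        have U: "U q i j = \<Phi> x (real q * s)" for q by (simp add: U_def cell_restrict_def x_def)
        show ?thesis
        proof (cases "k = 0")
          case True
          then have "w i j - half i j = - 1/2 * (\<Phi> x (t + s) - \<Phi> x t)"
            by (simp add: w_def half_def U t_def algebra_simps)
          moreover have "\<bar>\<Phi> x (t + s) - \<Phi> x t\<bar> \<le> B * s" using \<Phi>_lip[OF t(2,1), of x] s by simp
          ultimately show ?thesis using True by (simp add: \<theta>_def abs_mult)
        next
          case False
          then have tm: "real (k - 1) * s = t - s" by (simp add: t_def of_nat_diff algebra_simps)
          have "w i j - half i j = - 1/2 * (\<Phi> x (t + s) + \<Phi> x (t - s) - 2 * \<Phi> x t)"
            unfolding w_def half_def U tm t' t_def[symmetric] by (simp add: field_simps)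
          moreover have "\<bar>\<Phi> x (t + s) + \<Phi> x (t - s) - 2 * \<Phi> x t\<bar> \<le> B * s\<^sup>2"
            using time[of "k - 1"] k tm t by (intro \<Phi>_second) auto
          ultimately show ?thesis using False by (simp add: \<theta>_def abs_mult)
        qed
      qed
      define x where "x = (gp h i, gp h j)"
      have x: "x \<in> Omega L1 L2" unfolding x_def L by (rule gp_pair_in_Omega[OF h(1) ij])
      have Ux: "U k i j = \<Phi> x t" "U (Suc k) i j = \<Phi> x (t + s)"
        by (simp_all only: U_def cell_restrict_def x_def t_def[symmetric] t')
      have conv_err: "\<bar>dconv h m n JJ (U k) i j - conv x t\<bar> \<le> \<kappa>' * h\<^sup>2"
        "\<bar>dconv h m n JJ (U (Suc k)) i j - conv x (t + s)\<bar> \<le> \<kappa>' * h\<^sup>2"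
        using dconv_pconv_error[OF J perJ(3) \<Phi>[OF t(1)] per\<Phi>[OF t(1)] L h(1) mn, of i j]
          dconv_pconv_error[OF J perJ(3) \<Phi>[OF t(2)] per\<Phi>[OF t(2)] L h(1) mn, of i j]
        by (simp_all only: U_def JJ_def conv_def x_def t_def[symmetric] t') (simp_all add: \<kappa>'_def area_def)
      have q: "\<bar>dconv h m n JJ w i j - (conv x t + conv x (t + s)) / 2\<bar> \<le> \<kappa>' * h\<^sup>2 + 2 * A * area * \<theta>"
      proof -
        have "\<bar>dconv h m n JJ w i j - dconv h m n JJ half i j\<bar> \<le> 2 * A * area * \<theta>"
          using dconv_abs_le[where f = JJ, OF J_bd(3) w, where h = h and m = m and n = n and i = i and j = j] by (simp add: area_eq dconv_diff)
        moreover have "dconv h m n JJ half i j = (dconv h m n JJ (U k) i j + dconv h m n JJ (U (Suc k)) i j) / 2"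
          unfolding half_def by (rule dconv_average)
        ultimately show ?thesis using conv_err by (simp add: field_simps abs_le_iff)
      qed
      define \<rho> where "\<rho> = Bt * s ^ 3 + M * s * (1/2 * B ^ 3 * s\<^sup>2 + 2 * (\<kappa> * h\<^sup>2) * B + \<kappa>' * h\<^sup>2
          + (Q + 2 * A * area) * \<theta>)"
      have exact: "\<bar>U (Suc k) i j - U k i j + M * s * (eta (U k i j) (U (Suc k) i j)
            + (Ac i j + \<gamma>c) * (1/2 * (U k i j + U (Suc k) i j))
            - ((Ae i j + \<gamma>e) * w i j + dconv h m n JJ w i j))\<bar> \<le> \<rho>"
        unfolding \<rho>_def
      proof (rule scheme_step_consistency)
        show "\<bar>U (Suc k) i j - U k i j - s / 2 * (R x t + R x (t + s))\<bar> \<le> Bt * s ^ 3"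
          unfolding Ux using trap[OF x] t s by simp
        show "R x t = - M * (U k i j ^ 3 + \<gamma>c * U k i j - \<gamma>e * U k i j + (Ic - Ie) * U k i j - conv x t)"
          "R x (t + s) = - M * (U (Suc k) i j ^ 3 + \<gamma>c * U (Suc k) i j - \<gamma>e * U (Suc k) i j
              + (Ic - Ie) * U (Suc k) i j - conv x (t + s))"
          by (simp_all only: R_def Ux)
        show "\<bar>U (Suc k) i j - U k i j\<bar> \<le> B * s" unfolding Ux using \<Phi>_lip[OF t(2,1), of x] s by simp
        show "\<bar>w i j - 1/2 * (U k i j + U (Suc k) i j)\<bar> \<le> \<theta>" using w by (simp add: half_def)
      qed (use U_bd k M_nonneg s coeff_err Q q in auto)
      have wdiff: "\<bar>w i j - w' i j\<bar> \<le> 2 * \<delta>" for i j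
      proof -
        have "w i j - w' i j = 3/2 * e k i j - 1/2 * e (k - 1) i j"
          by (simp add: w_def w'_def e_def algebra_simps)
        then show ?thesis using ek[of i j] ek'[of i j] by (simp add: abs_le_iff)
      qed
      have "\<bar>U (Suc k) i j - \<phi> (Suc k) i j\<bar>
          \<le> (1 + M * s * (3/2 * (B + 1)\<^sup>2 + (Ac i j + \<gamma>c) / 2)) * \<bar>U k i j - \<phi> k i j\<bar>
             + M * s * ((Q + 2 * A * area) * (2 * \<delta>)) + \<rho>"
      proof (rule scheme_step_stability[OF _ _ _ _ _ exact])
        show "\<bar>U k i j\<bar> \<le> B + 1" "\<bar>U (Suc k) i j\<bar> \<le> B + 1"
          using U_bd[of k i j] U_bd[of "Suc k" i j] k by auto
        \<comment> \<open>Here \<open>\<delta> \<le> 1\<close> enters: it bounds the numerical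
          solution by \<open>B + 1\<close>.\<close>
        show "\<bar>\<phi> k i j\<bar> \<le> B + 1"
          using U_bd[of k i j] ek[of i j] \<delta>1 k by (simp add: e_def)
        show "0 \<le> M * s" "0 \<le> Ac i j + \<gamma>c" using M_nonneg s coeff_bd gamma_nonneg by auto
        show "\<phi> (Suc k) i j - \<phi> k i j = - (M * s) * (eta (\<phi> k i j) (\<phi> (Suc k) i j)
            + (Ac i j + \<gamma>c) * (1/2 * (\<phi> k i j + \<phi> (Suc k) i j))
            - ((Ae i j + \<gamma>e) * w' i j + dconv h m n JJ w' i j))"
          using nAC_scheme_step[OF scheme, of k i j] by (simp only: Ac_def Ae_def JJ_def J_def w'_def)
        have "(Ae i j + \<gamma>e) * w i j + dconv h m n JJ w i j - ((Ae i j + \<gamma>e) * w' i j + dconv h m n JJ w' i j)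
            = (Ae i j + \<gamma>e) * (w i j - w' i j) + dconv h m n JJ (\<lambda>i j. w i j - w' i j) i j"
          by (simp add: dconv_diff algebra_simps)
        also have "\<bar>\<dots>\<bar> \<le> \<bar>Ae i j + \<gamma>e\<bar> * \<bar>w i j - w' i j\<bar> + \<bar>dconv h m n JJ (\<lambda>i j. w i j - w' i j) i j\<bar>"
          by (rule order_trans[OF abs_triangle_ineq]) (simp add: abs_mult)
        also have "\<dots> \<le> Q * (2 * \<delta>) + 2 * A * area * (2 * \<delta>)"
          using dconv_abs_le[where f = JJ, OF J_bd(3) wdiff, where h = h and m = m and n = n and i = i and j = j] pos
          by (intro add_mono mult_mono Q wdiff) (auto simp: area_eq)
        finally show "\<bar>(Ae i j + \<gamma>e) * w i j + dconv h m n JJ w i j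
            - ((Ae i j + \<gamma>e) * w' i j + dconv h m n JJ w' i j)\<bar> \<le> (Q + 2 * A * area) * (2 * \<delta>)"
          by (simp add: algebra_simps)
      qed
      also have "\<dots> \<le> (1 + M * s * (3/2 * (B + 1)\<^sup>2 + (A * area + \<gamma>c) / 2)) * \<delta>
             + M * s * ((Q + 2 * A * area) * (2 * \<delta>)) + (if k = 0 then A1 else A2)"
      proof -
        have "M * s * (3/2 * (B + 1)\<^sup>2 + (Ac i j + \<gamma>c) / 2) \<le> M * s * (3/2 * (B + 1)\<^sup>2 + (A * area + \<gamma>c) / 2)"
          using M_nonneg s coeff_bd(2)[of i j] by (intro mult_left_mono) simp_all
        moreover have "0 \<le> M * s * (3/2 * (B + 1)\<^sup>2 + (A * area + \<gamma>c) / 2)"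
          using M_nonneg s A area gamma_nonneg by (intro mult_nonneg_nonneg add_nonneg_nonneg) auto
        ultimately have e_part: "(1 + M * s * (3/2 * (B + 1)\<^sup>2 + (Ac i j + \<gamma>c) / 2)) * \<bar>U k i j - \<phi> k i j\<bar>
            \<le> (1 + M * s * (3/2 * (B + 1)\<^sup>2 + (A * area + \<gamma>c) / 2)) * \<delta>"
          using ek[of i j] by (intro mult_mono) (auto simp: e_def)
        \<comment> \<open>Treats both cases at once: as \<open>s \<le> 1\<close>, the quantity
          \<open>z\<close> dominates \<open>s^2\<close> and \<open>h^2\<close>, and
          \<open>B * z\<close> dominates \<open>\<theta>\<close>.\<close>
        define \<omega> where "\<omega> = (if k = 0 then s else s\<^sup>2)"
        have \<omega>: "s\<^sup>2 \<le> \<omega>" "0 \<le> \<omega>" "\<theta> = B * \<omega>"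
          using s s1 by (auto simp: \<omega>_def \<theta>_def power2_eq_square mult_left_le)
        define z where "z = \<omega> + h\<^sup>2"
        have z: "s\<^sup>2 \<le> z" "h\<^sup>2 \<le> z" "\<theta> \<le> B * z"
          using \<omega> B by (auto simp: z_def mult_left_mono add_increasing2)
        have "s ^ 3 \<le> s * z"
          using z(1) s by (simp add: power3_eq_cube power2_eq_square mult_left_mono)
        then have 1: "Bt * s ^ 3 \<le> Bt * (s * z)" using Bt by (rule mult_left_mono)
        have "1/2 * B ^ 3 * s\<^sup>2 \<le> 1/2 * B ^ 3 * z" "\<kappa> * h\<^sup>2 * B \<le> \<kappa> * z * B" "\<kappa>' * h\<^sup>2 \<le> \<kappa>' * z"
          "(Q + 2 * A * area) * \<theta> \<le> (Q + 2 * A * area) * (B * z)"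
          using z B pos by (auto intro!: mult_left_mono mult_right_mono)
        then have "1/2 * B ^ 3 * s\<^sup>2 + 2 * (\<kappa> * h\<^sup>2) * B + \<kappa>' * h\<^sup>2 + (Q + 2 * A * area) * \<theta>
            \<le> 1/2 * B ^ 3 * z + 2 * (\<kappa> * z) * B + \<kappa>' * z + (Q + 2 * A * area) * (B * z)"
          by linarith
        then have 2: "M * s * (1/2 * B ^ 3 * s\<^sup>2 + 2 * (\<kappa> * h\<^sup>2) * B + \<kappa>' * h\<^sup>2 + (Q + 2 * A * area) * \<theta>)
            \<le> M * s * (1/2 * B ^ 3 * z + 2 * (\<kappa> * z) * B + \<kappa>' * z + (Q + 2 * A * area) * (B * z))"
          using M_nonneg s by (intro mult_left_mono) simp_all
        have "\<rho> \<le> Bt * (s * z) + M * s * (1/2 * B ^ 3 * z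
            + 2 * (\<kappa> * z) * B + \<kappa>' * z + (Q + 2 * A * area) * (B * z))"
          unfolding \<rho>_def by (rule add_mono[OF 1 2])
        also have "\<dots> = C1 * (s * z)" by (simp add: C1_def algebra_simps)
        also have "\<dots> = (if k = 0 then A1 else A2)" by (simp add: A1_def A2_def z_def \<omega>_def)
        finally have "\<rho> \<le> (if k = 0 then A1 else A2)" .
        then show ?thesis by (intro add_mono e_part order_refl)
      qed
      also have "\<dots> = (1 + cc * s) * \<delta> + (if k = 0 then A1 else A2)"
        by (simp add: cc_def algebra_simps)
      finally show "\<bar>e (Suc k) i j\<bar> \<le> (1 + cc * s) * \<delta> + (if k = 0 then A1 else A2)"
        by (simp add: e_def)
    qed

    \<comment> \<open>Accumulation over all steps and passage to the norm\<close>
    have nn: "0 \<le> cc * s" "0 \<le> A1" "0 \<le> A2" using cc s C1 by (auto simp: A1_def A2_def)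
    have total: "(1 + cc * s) ^ l * (A1 + real l * A2) \<le> E * (h\<^sup>2 + s\<^sup>2)"
    proof -
      have "(1 + cc * s) ^ l \<le> exp (cc * s) ^ l" using nn by (intro power_mono) auto
      also have "\<dots> = exp (cc * (real l * s))" by (simp flip: exp_of_nat_mult add: mult_ac)
      also have "\<dots> \<le> exp (cc * T)" using cc l by (simp add: mult_left_mono)
      finally have "(1 + cc * s) ^ l \<le> exp (cc * T)" .
      moreover have "A1 + real l * A2 \<le> C1 * (1 + T) * (h\<^sup>2 + s\<^sup>2)"
      proof -
        \<comment> \<open>The factor \<open>s\<close> in \<open>A1\<close> lifts the first-order
          defect of the first step to second order.\<close>
        have "s * h\<^sup>2 \<le> h\<^sup>2" using s s1 by (simp add: mult_left_le_one_le)
        then have "A1 \<le> C1 * (h\<^sup>2 + s\<^sup>2)"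
          unfolding A1_def using C1 by (intro mult_left_mono) (auto simp: power2_eq_square algebra_simps)
        moreover have "C1 * ((real l * s) * (h\<^sup>2 + s\<^sup>2)) \<le> C1 * (T * (h\<^sup>2 + s\<^sup>2))"
          using C1 l by (intro mult_left_mono mult_right_mono) auto
        then have "real l * A2 \<le> C1 * (T * (h\<^sup>2 + s\<^sup>2))" by (simp add: A2_def algebra_simps)
        ultimately show ?thesis by (simp add: algebra_simps)
      qed
      ultimately have "(1 + cc * s) ^ l * (A1 + real l * A2) \<le> exp (cc * T) * (C1 * (1 + T) * (h\<^sup>2 + s\<^sup>2))"
        using nn by (intro mult_mono) auto
      then show ?thesis by (simp add: E_def mult.assoc)
    qed
    have small: "E * (h\<^sup>2 + s\<^sup>2) \<le> 1"
    proof -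
      have "h\<^sup>2 + s\<^sup>2 \<le> d0\<^sup>2 + d0\<^sup>2" using s h by (intro add_mono power_mono) auto
      then show ?thesis using mult_left_mono[OF _ E] d0(3) by (meson order_trans)
    qed
    have "\<bar>(\<lambda>(i, j). e l i j) p\<bar> \<le> (1 + cc * s) ^ l * (A1 + real l * A2)" for p
    proof (rule error_recursion_bound[where e = "\<lambda>k (i, j). e k i j", OF _ nn])
      show "(case p of (i, j) \<Rightarrow> e 0 i j) = 0" for p
        by (cases p) (simp add: e_def U_def \<phi>0)
      fix k \<delta> p
      assume "k < l" "\<delta> \<le> 1" "\<And>p. \<bar>case p of (i, j) \<Rightarrow> e k i j\<bar> \<le> \<delta>"
        "\<And>p. \<bar>case p of (i, j) \<Rightarrow> e (k - 1) i j\<bar> \<le> \<delta>"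
      then show "\<bar>case p of (i, j) \<Rightarrow> e (Suc k) i j\<bar> \<le> (1 + cc * s) * \<delta> + (if k = 0 then A1 else A2)"
        using step[of k \<delta>] by (cases p) (simp only: prod.case, metis prod.case)
    qed (use total small in linarith)
    from this[of "(_, _)"] have "\<bar>e l i j\<bar> \<le> E * (h\<^sup>2 + s\<^sup>2)" for i j
      using total by (metis (no_types, lifting) order_trans prod.case)
    then have "grid_norm2 h m n (e l) \<le> sqrt area * (E * (h\<^sup>2 + s\<^sup>2))"
      using grid_norm2_le[of "e l" _ h m n] h by (simp add: area_eq)
    also have "\<dots> \<le> (sqrt area * E + 1) * (h\<^sup>2 + s\<^sup>2)" by (simp add: algebra_simps)
    finally show ?thesis by (simp add: e_def U_def)
  qed
  \<comment> \<open>The added 1 keeps the constant positive even when \<open>E\<close>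
    vanishes.\<close>
  have "0 < sqrt area * E + 1" using area E by (simp add: add_nonneg_pos)
  then show ?thesis
    using d0(1) main by (intro exI[of _ d0] exI[of _ "sqrt area * E + 1"] conjI allI impI) auto
qed

end
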